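(* Assume the following. ($A_1$) $X$ is a reflexive Banach space, and $K\subsetneq X$ is non-empty, closed and convex. ($A_2$) $X_\varphi$ is a Banach space and $\gamma_\varphi\in\mathcal{L}(X,X_\varphi)$, with a constant $c_\varphi>0$ such that $\|\gamma_\varphi v\|_{X_\varphi}\le c_\varphi\|v\|_X$ for all $v\in X$. ($A_3$) $X_j$ is a Banach space and $\gamma_j\in\mathcal{L}(X,X_j)$, with a constant $c_j>0$ such that $\|\gamma_j v\|_{X_j}\le c_j\|v\|_X$ for all $v\in X$. ($A_4$) $A\colon X\to X^*$ is pseudomonotone, and there is a constant $m_A>0$ such that $\langle Av_1-Av_2,v_1-v_2\rangle\ge m_A\|v_1-v_2\|_X^2$ for all $v_1,v_2\in X$. ($A_5$) $\varphi\colon X_\varphi\times X_\varphi\to\mathbb{R}$ is such that $\varphi(z,\cdot)\colon X_\varphi\to\mathbb{R}$ is convex and lower semicontinuous for all $z\in X_\varphi$, and for a constant $\alpha_\varphi\ge 0$, \[ \varphi(z_1,z_4)-\varphi(z_1,z_3)+\varphi(z_2,z_3)-\varphi(z_2,z_4)\le\alpha_\varphi\|z_1-z_2\|_{X_\varphi}\|z_3-z_4\|_{X_\varphi}\quad\forall\,z_1,z_2,z_3,z_4\in X_\varphi. \] ($A_6$) $j\colon X_j\to\mathbb{R}$ is locally Lipschitz, and for some constants $c_0,c_1,\alpha_j\ge 0$, \[ \|\partial j(z)\|_{X_j^*}\le c_0+c_1\|z\|_{X_j}\quad\forall\,z\in X_j, \] \[ j^0(z_1;z_2-z_1)+j^0(z_2;z_1-z_2)\le\alpha_j\|z_1-z_2\|_{X_j}^2\quad\forall\,z_1,z_2\in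 X_j. \] ($A_7$) $\alpha_\varphi c_\varphi^2+\alpha_j c_j^2<m_A$. ($A_8$) $f\in X^*$. ($A_9$) For each discretization parameter $h>0$, $X^h\subset X$ is a finite dimensional subspace; for any $v\in X$ there exist $v^h\in X^h$ such that $\lim_{h\to 0}\|v^h-v\|_X=0$; and for any $v\in K$ there exist $v^h\in X^h\cap K$ such that $\lim_{h\to 0}\|v^h-v\|_X=0$. ($A_{10}$) $\gamma_\varphi\colon X\to X_\varphi$ and $\gamma_j\colon X\to X_j$ are compact operators. Let $P\colon X\to X^*$ be a penalty operator for $K$. Let $u\in K$ be the unique solution of \[ \langle Au,v-u\rangle+\varphi(\gamma_\varphi u,\gamma_\varphi v)-\varphi(\gamma_\varphi u,\gamma_\varphi u)+j^0(\gamma_j u;\gamma_j v-\gamma_j u)\ge\langle f,v-u\rangle\quad\forall\,v\in K, \] and, for $h,\epsilon>0$, let $u^h_\epsilon\in X^h$ be the unique solution of \[ \langle Au^h_\epsilon,v^h-u^h_\epsilon\rangle+\frac1\epsilon\langle Pu^h_\epsilon,v^h-u^h_\epsilon\rangle+\varphi(\gamma_\varphi u^h_\epsilon,\gamma_\varphi v^h)-\varphi(\gamma_\varphi u^h_\epsilon,\gamma_\varphi u^h_\epsilon)+j^0(\gamma_j u^h_\epsilon;\gamma_j v^h-\gamma_j u^h_\epsilon)\ge\langle f,v^h-u^h_\epsilon\rangle\quad\forall\,v^h\in X^h. \] Then \[ u^h_\epsilon\to u\quad\text{in }X\text{ as }h,\epsilon\to 0. \]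
   Context: All spaces are real. $X^*$ is the dual of $X$, $\langle\cdot,\cdot\rangle$ is the duality pairing of $X^*$ and $X$, and $\mathcal{L}(X,Y)$ is the space of continuous linear operators from $X$ to $Y$; $\rightharpoonup$ denotes weak convergence. An operator $A\colon X\to X^*$ is pseudomonotone if it is bounded (maps bounded sets to bounded sets) and $u_n\rightharpoonup u$ in $X$ together with $\limsup_{n\to\infty}\langle Au_n,u_n-u\rangle\le 0$ imply $\langle Au,u-v\rangle\le\liminf_{n\to\infty}\langle Au_n,u_n-v\rangle$ for all $v\in X$. It is demicontinuous if $u_n\to u$ in $X$ implies $Au_n\rightharpoonup Au$ in $X^*$. A penalty operator for the set $K$ is an operator $P\colon X\to X^*$ that is bounded (maps bounded sets to bounded sets), demicontinuous, monotone, and satisfies $\mathrm{Ker}(P)=\{v\in X: Pv=0\}=K$. For a locally Lipschitz $\psi\colon Y\to\mathbb{R}$ on a normed space $Y$, the Clarke generalized directional derivative at $x$ in direction $v$ is $\psi^0(x;v)=\limsup_{y\to x,\ \lambda\downarrow 0}\frac{\psi(y+\lambda v)-\psi(y)}{\lambda}$, and the Clarke subdifferential is $\partial\psi(x)=\{\zeta\in Y^*: \psi^0(x;v)\ge\langle\zeta,v\rangle\ \forall v\in Y\}$. A bound $\|\partial j(z)\|_{X_j^*}\le C$ means $\|\zeta\|_{X_j^*}\le C$ for every $\zeta\in\partial j(z)$. Under ($A_1$)–($A_8$), both the constrained inequality on $K$ and the discrete penalized inequality on $X^h$ have unique solutions. The parameters $h$ and $\epsilon$ tend to zero simultaneously and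 independently: the convergence means that for every $\eta>0$ there are $h_0,\epsilon_0>0$ such that $\|u^h_\epsilon-u\|_X<\eta$ whenever $0<h<h_0$ and $0<\epsilon<\epsilon_0$. *)

theory Defs
  imports "HOL-Analysis.Analysis"
begin

text \<open>
  The dual of a normed space \<open>'a\<close> is the type \<open>'a \<Rightarrow>\<^sub>L real\<close> with its operator norm, and the
  duality pairing of \<open>\<zeta>\<close> and \<open>v\<close> is \<open>blinfun_apply \<zeta> v\<close>.
\<close>

text \<open>Surjectivity of the canonical embedding into the bidual.\<close>

definition reflexive_space :: "'a::real_normed_vector itself \<Rightarrow> bool" where
  "reflexive_space _ \<longleftrightarrow>
     (\<forall>F :: ('a \<Rightarrow>\<^sub>L real) \<Rightarrow>\<^sub>L real. \<exists>x :: 'a. \<forall>\<zeta>. blinfun_apply F \<zeta> = blinfun_apply \<zeta> x)"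

text \<open>
  For a sequence in a dual space this is convergence against the bidual, not weak-star convergence.
\<close>

definition weakly_converges :: "(nat \<Rightarrow> 'a::real_normed_vector) \<Rightarrow> 'a \<Rightarrow> bool" where
  "weakly_converges x l \<longleftrightarrow>
     (\<forall>\<zeta> :: 'a \<Rightarrow>\<^sub>L real. (\<lambda>n. blinfun_apply \<zeta> (x n)) \<longlonglongrightarrow> blinfun_apply \<zeta> l)"

definition bounded_operator :: "('a::real_normed_vector \<Rightarrow> 'b::real_normed_vector) \<Rightarrow> bool" where
  "bounded_operator A \<longleftrightarrow> (\<forall>S. bounded S \<longrightarrow> bounded (A ` S))"

definition compact_operator :: "('a::real_normed_vector \<Rightarrow> 'b::real_normed_vector) \<Rightarrow> bool" where
  "compact_operator T \<longleftrightarrow> (\<forall>S. bounded S \<longrightarrow> compact (closure (T ` S)))"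

text \<open>
  Upper and lower limits of real sequences are taken in the extended reals, where they always exist.
\<close>

definition pseudomonotone :: "('a::real_normed_vector \<Rightarrow> ('a \<Rightarrow>\<^sub>L real)) \<Rightarrow> bool" where
  "pseudomonotone A \<longleftrightarrow> bounded_operator A \<and>
     (\<forall>u l. weakly_converges u l \<longrightarrow>
        limsup (\<lambda>n. ereal (blinfun_apply (A (u n)) (u n - l))) \<le> 0 \<longrightarrow>
        (\<forall>v. ereal (blinfun_apply (A l) (l - v))
               \<le> liminf (\<lambda>n. ereal (blinfun_apply (A (u n)) (u n - v)))))"

definition demicontinuous :: "('a::real_normed_vector \<Rightarrow> ('a \<Rightarrow>\<^sub>L real)) \<Rightarrow> bool" where
  "demicontinuous A \<longleftrightarrow> (\<forall>u l. u \<longlonglongrightarrow> l \<longrightarrow> weakly_converges (\<lambda>n. A (u n)) (A l))"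

definition monotone_operator :: "('a::real_normed_vector \<Rightarrow> ('a \<Rightarrow>\<^sub>L real)) \<Rightarrow> bool" where
  "monotone_operator A \<longleftrightarrow> (\<forall>u v. blinfun_apply (A u - A v) (u - v) \<ge> 0)"

definition penalty_operator ::
  "('a::real_normed_vector \<Rightarrow> ('a \<Rightarrow>\<^sub>L real)) \<Rightarrow> 'a set \<Rightarrow> bool" where
  "penalty_operator P K \<longleftrightarrow>
     bounded_operator P \<and> demicontinuous P \<and> monotone_operator P \<and> {v. P v = 0} = K"

definition lower_semicontinuous :: "('a::topological_space \<Rightarrow> real) \<Rightarrow> bool" where
  "lower_semicontinuous g \<longleftrightarrow> (\<forall>x. ereal (g x) \<le> Liminf (nhds x) (\<lambda>y. ereal (g y)))"

definition locally_lipschitz :: "('a::metric_space \<Rightarrow> real) \<Rightarrow> bool" where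
  "locally_lipschitz g \<longleftrightarrow> (\<forall>x. \<exists>r>0. \<exists>L. L-lipschitz_on (ball x r) g)"

text \<open>
  The generalized directional derivative is a joint upper limit over \<open>y \<rightarrow> x\<close> (with \<open>y = x\<close>
  allowed) and \<open>t \<down> 0\<close>. For locally Lipschitz functions it is finite (proved below), so that
  passing from \<open>ereal\<close> to \<open>real\<close> loses nothing.
\<close>

definition clarke_deriv :: "('a::real_normed_vector \<Rightarrow> real) \<Rightarrow> 'a \<Rightarrow> 'a \<Rightarrow> real" where
  "clarke_deriv g x v =
     real_of_ereal (Limsup (nhds x \<times>\<^sub>F at_right 0)
       (\<lambda>(y, t). ereal ((g (y + t *\<^sub>R v) - g y) / t)))"

definition clarke_subdiff :: "('a::real_normed_vector \<Rightarrow> real) \<Rightarrow> 'a \<Rightarrow> ('a \<Rightarrow>\<^sub>L real) set" where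
  "clarke_subdiff g x = {\<zeta>. \<forall>v. clarke_deriv g x v \<ge> blinfun_apply \<zeta> v}"

lemma clarke_deriv_ereal:
  assumes "locally_lipschitz g"
  shows "ereal (clarke_deriv g x v) =
    Limsup (nhds x \<times>\<^sub>F at_right 0) (\<lambda>(y, t). ereal ((g (y + t *\<^sub>R v) - g y) / t))"
proof -
  let ?F = "nhds x \<times>\<^sub>F at_right (0::real)"
  let ?q = "\<lambda>(y, t). (g (y + t *\<^sub>R v) - g y) / t"
  obtain r L where r: "r > 0" and L: "L-lipschitz_on (ball x r) g"
    using assms unfolding locally_lipschitz_def by blast
  have nontriv: "?F \<noteq> bot"
    by (simp add: prod_filter_eq_bot)
  have "((\<lambda>(y, t). y + t *\<^sub>R v) \<longlongrightarrow> x + 0 *\<^sub>R v) ?F"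
    unfolding case_prod_beta
    by (intro tendsto_intros filterlim_compose[OF _ filterlim_fst] filterlim_compose[OF _ filterlim_snd])
       (auto intro: tendsto_ident_at filterlim_ident)
  then have 1: "\<forall>\<^sub>F p in ?F. fst p + snd p *\<^sub>R v \<in> ball x r"
    using r by (auto simp: case_prod_beta dest: topological_tendstoD[where S = "ball x r"])
  have 2: "\<forall>\<^sub>F p in ?F. fst p \<in> ball x r \<and> snd p > 0"
    using r by (intro eventually_prodI eventually_nhds_in_open)
       (auto simp: eventually_at_right_less)
  have bd: "\<forall>\<^sub>F p in ?F. \<bar>?q p\<bar> \<le> L * norm v"
    using 1 2
  proof eventually_elim
    case (elim p)
    then have "\<bar>g (fst p + snd p *\<^sub>R v) - g (fst p)\<bar> \<le> L * dist (fst p + snd p *\<^sub>R v) (fst p)"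
      using lipschitz_onD[OF L] by (metis dist_real_def)
    with elim show ?case
      by (simp add: case_prod_beta dist_norm divide_le_eq mult_ac)
  qed
  have "Limsup ?F (\<lambda>p. ereal (?q p)) \<le> ereal (L * norm v)"
    by (rule Limsup_bounded) (use bd in eventually_elim, auto)
  moreover have "ereal (- (L * norm v)) \<le> Limsup ?F (\<lambda>p. ereal (?q p))"
    by (rule le_Limsup[OF nontriv]) (use bd in eventually_elim, auto)
  ultimately have "\<bar>Limsup ?F (\<lambda>p. ereal (?q p))\<bar> \<noteq> \<infinity>"
    by auto
  then show ?thesis
    unfolding clarke_deriv_def by (simp add: ereal_real case_prod_unfold)
qed

end

theory Submission
  imports Defs
begin

text \<open>
  Suppose that solutions for some \<open>h, \<epsilon> \<rightarrow> 0\<close> stay away from \<open>u\<close>. Testing with approximations of \<open>u\<close>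
  in \<open>X\<^sup>h \<inter> K\<close>, where the penalty term has a favourable sign, shows that they are bounded.
  Compactness makes the images under \<open>\<gamma>\<phi>\<close> and \<open>\<gamma>j\<close> converge along a subsequence, and reflexivity gives
  a point \<open>l\<close> with \<open>\<zeta> l \<le> limsup \<zeta> (U n)\<close> for every functional \<open>\<zeta>\<close>: the upper limit is a sublinear
  function of \<open>\<zeta>\<close>, so by Hahn--Banach it dominates a bounded functional on the dual. This weak
  substitute for weak sequential compactness suffices because each of the following steps uses a
  single functional. Since the penalty term is \<open>O(\<epsilon>)\<close>, Minty's trick yields \<open>P l = 0\<close>, that is
  \<open>l \<in> K\<close>. Testing with approximations of \<open>l\<close>, strong monotonicity gives
  \<open>mA * norm (U n - l)^2 \<le> o(1) + (f - A l) (U n - l)\<close>, and the last term has nonpositive lower limit;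
  hence a subsequence converges to \<open>l\<close> strongly. Comparing the limit with \<open>u\<close>, the smallness condition
  forces \<open>l = u\<close>.
\<close>

subsection \<open>Hahn--Banach and weak cluster points\<close>

text \<open>The scaling condition is only an inequality, which is what infima deliver; equality is
  recovered in \<open>sublinear_scale\<close> by scaling back with \<open>inverse t\<close>.\<close>

definition sublinear :: "('a::real_vector \<Rightarrow> real) \<Rightarrow> bool" where
  "sublinear q \<longleftrightarrow> (\<forall>x y. q (x + y) \<le> q x + q y) \<and> (\<forall>t\<ge>0. \<forall>x. q (t *\<^sub>R x) \<le> t * q x)"

lemma sublinear_add: "sublinear q \<Longrightarrow> q (x + y) \<le> q x + q y"
  and sublinear_scale_le: "sublinear q \<Longrightarrow> t \<ge> 0 \<Longrightarrow> q (t *\<^sub>R x) \<le> t * q x"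
  by (auto simp: sublinear_def)

lemma sublinear_zero:
  assumes "sublinear q"
  shows "q 0 = 0"
  using sublinear_add[OF assms, of 0 0] sublinear_scale_le[OF assms, of 0 0] by simp

lemma sublinear_scale:
  assumes q: "sublinear q" and t: "t \<ge> 0"
  shows "q (t *\<^sub>R x) = t * q x"
proof (cases "t = 0")
  case False
  then have "t > 0" using t by simp
  have "q x \<le> inverse t * q (t *\<^sub>R x)"
    using sublinear_scale_le[OF q, of "inverse t" "t *\<^sub>R x"] \<open>t > 0\<close> by simp
  then have "t * q x \<le> q (t *\<^sub>R x)"
    using \<open>t > 0\<close> by (simp add: field_simps)
  then show ?thesis
    using sublinear_scale_le[OF q t, of x] by simp
qed (simp add: sublinear_zero[OF q])

lemma sublinear_neg:
  assumes "sublinear q"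
  shows "- q (- x) \<le> q x"
  using sublinear_add[OF assms, of x "- x"] sublinear_zero[OF assms] by simp

text \<open>The pointwise infimum works. It is finite because every member satisfies
  \<open>- p (- x) \<le> q x\<close>, and subadditive because, of two members of a chain, the
  smaller one can be used at both points. This is the chain condition for Zorn's lemma.\<close>

lemma sublinear_chain_lower_bound:
  fixes C :: "('a::real_vector \<Rightarrow> real) set"
  assumes C: "C \<noteq> {}" and sub: "\<And>q. q \<in> C \<Longrightarrow> sublinear q" and le: "\<And>q. q \<in> C \<Longrightarrow> q \<le> p"
    and chain: "\<And>q q'. q \<in> C \<Longrightarrow> q' \<in> C \<Longrightarrow> q \<le> q' \<or> q' \<le> q"
  obtains r where "sublinear r" "\<And>q. q \<in> C \<Longrightarrow> r \<le> q"
proof -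
  define r where "r = (\<lambda>x. INF q\<in>C. q x)"
  have bdd: "bdd_below ((\<lambda>q. q x) ` C)" for x
  proof (rule bdd_belowI2)
    fix q assume "q \<in> C"
    then show "- p (- x) \<le> q x"
      using sublinear_neg[OF sub, of q x] le_funD[OF le, of q "- x"] by linarith
  qed
  have lower: "r x \<le> q x" if "q \<in> C" for q x
    unfolding r_def using bdd that by (rule cINF_lower)
  have greatest: "c \<le> r x" if "\<And>q. q \<in> C \<Longrightarrow> c \<le> q x" for c x
    unfolding r_def using C that by (rule cINF_greatest)
  have below: "r \<le> q" if "q \<in> C" for q
    using lower[OF that] by (simp add: le_fun_def)
  have pair: "r (x + y) \<le> q x + q' y" if "q \<in> C" "q' \<in> C" for q q' x y
    using chain[OF that]
  proof
    assume "q \<le> q'"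
    then show ?thesis
      using lower[OF that(1), of "x + y"] sublinear_add[OF sub[OF that(1)], of x y] le_funD[of q q' y]
      by linarith
  next
    assume "q' \<le> q"
    then show ?thesis
      using lower[OF that(2), of "x + y"] sublinear_add[OF sub[OF that(2)], of x y] le_funD[of q' q x]
      by linarith
  qed
  have "r (x + y) \<le> r x + r y" for x y
  proof -
    have "r (x + y) - q x \<le> r y" if "q \<in> C" for q
      by (rule greatest) (use pair[OF that] in \<open>simp add: algebra_simps\<close>)
    then have "r (x + y) - r y \<le> r x"
      by (intro greatest) (simp add: algebra_simps)
    then show ?thesis by simp
  qed
  moreover have "r (t *\<^sub>R x) \<le> t * r x" if "t \<ge> 0" for t x
  proof (cases "t = 0")
    case True
    obtain q where "q \<in> C" using C by blast
    then show ?thesis using True lower[of q 0] sublinear_zero[OF sub, of q] by simp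
  next
    case False
    then have "t > 0" using that by simp
    have "r (t *\<^sub>R x) / t \<le> r x"
    proof (rule greatest)
      fix q assume "q \<in> C"
      then have "r (t *\<^sub>R x) \<le> t * q x"
        using lower sublinear_scale[OF sub that] by metis
      then show "r (t *\<^sub>R x) / t \<le> q x" using \<open>t > 0\<close> by (simp add: field_simps)
    qed
    then show ?thesis using \<open>t > 0\<close> by (simp add: field_simps)
  qed
  ultimately have "sublinear r" by (simp add: sublinear_def)
  then show ?thesis using below by (rule that)
qed

text \<open>The infimum of \<open>q (x + t *\<^sub>R y) - t * q y\<close> over
  \<open>t \<ge> 0\<close> works: \<open>t = 0\<close> and \<open>t = 1\<close> give the two bounds.
  In particular \<open>r (- y) \<le> - q y\<close>, so \<open>r\<close> is linear along
  \<open>y\<close>.\<close>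

lemma sublinear_direction:
  fixes q :: "'a::real_vector \<Rightarrow> real"
  assumes q: "sublinear q"
  obtains r where "sublinear r" "r \<le> q" "\<And>x. r x \<le> q (x + y) - q y"
proof -
  define r where "r = (\<lambda>x. INF t\<in>{0..}. q (x + t *\<^sub>R y) - t * q y)"
  have bdd: "bdd_below ((\<lambda>t. q (x + t *\<^sub>R y) - t * q y) ` {0..})" for x
  proof (rule bdd_belowI2)
    fix t :: real assume "t \<in> {0..}"
    then have "t * q y = q ((x + t *\<^sub>R y) + (- x))" by (simp add: sublinear_scale[OF q])
    also have "\<dots> \<le> q (x + t *\<^sub>R y) + q (- x)" by (rule sublinear_add[OF q])
    finally show "- q (- x) \<le> q (x + t *\<^sub>R y) - t * q y" by simp
  qed
  have lower: "r x \<le> q (x + t *\<^sub>R y) - t * q y" if "t \<ge> 0" for x t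
    unfolding r_def using that by (intro cINF_lower[OF bdd]) simp
  have greatest: "c \<le> r x" if "\<And>t. t \<ge> 0 \<Longrightarrow> c \<le> q (x + t *\<^sub>R y) - t * q y" for c x
    unfolding r_def using that by (intro cINF_greatest) auto
  have "r (x + x') \<le> r x + r x'" for x x'
  proof -
    \<comment> \<open>Independent parameters \<open>t\<close> and \<open>s\<close>, with
      \<open>t + s\<close> for the sum, allow the two infima to be taken one after the
      other.\<close>
    have *: "r (x + x') \<le> (q (x + t *\<^sub>R y) - t * q y) + (q (x' + s *\<^sub>R y) - s * q y)"
      if "t \<ge> 0" "s \<ge> 0" for s t
    proof -
      have "r (x + x') \<le> q ((x + t *\<^sub>R y) + (x' + s *\<^sub>R y)) - (t + s) * q y"
        using lower[of "t + s" "x + x'"] that by (simp add: algebra_simps)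
      also have "\<dots> \<le> q (x + t *\<^sub>R y) + q (x' + s *\<^sub>R y) - (t + s) * q y"
        by (simp add: sublinear_add[OF q])
      finally show ?thesis by (simp add: algebra_simps)
    qed
    have "r (x + x') - (q (x + t *\<^sub>R y) - t * q y) \<le> r x'" if "t \<ge> 0" for t
      by (rule greatest) (use *[OF that] in \<open>simp add: algebra_simps\<close>)
    then have "r (x + x') - r x' \<le> r x"
      by (intro greatest) (simp add: algebra_simps)
    then show ?thesis by simp
  qed
  moreover have "r (s *\<^sub>R x) \<le> s * r x" if "s \<ge> 0" for s x
  proof (cases "s = 0")
    case True
    then show ?thesis using lower[of 0 0] sublinear_zero[OF q] by simp
  next
    case False
    then have "s > 0" using that by simp
    have "r (s *\<^sub>R x) / s \<le> r x"
    proof (rule greatest)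
      fix t :: real assume "t \<ge> 0"
      then have "r (s *\<^sub>R x) \<le> q (s *\<^sub>R (x + t *\<^sub>R y)) - (s * t) * q y"
        using lower[of "s * t" "s *\<^sub>R x"] that by (simp add: algebra_simps)
      also have "\<dots> = s * (q (x + t *\<^sub>R y) - t * q y)"
        unfolding sublinear_scale[OF q that] by (simp add: algebra_simps)
      finally show "r (s *\<^sub>R x) / s \<le> q (x + t *\<^sub>R y) - t * q y"
        using \<open>s > 0\<close> by (simp add: field_simps)
    qed
    then show ?thesis using \<open>s > 0\<close> by (simp add: field_simps)
  qed
  ultimately have "sublinear r" by (simp add: sublinear_def)
  moreover have "r \<le> q" using lower[of 0] by (simp add: le_fun_def)
  moreover have "r x \<le> q (x + y) - q y" for x using lower[of 1 x] by simp
  ultimately show ?thesis by (rule that)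
qed

text \<open>Minimality identifies \<open>q\<close> with the function from
  \<open>sublinear_direction\<close>, whose last bound then says that \<open>q\<close> is
  superadditive.\<close>

lemma minimal_sublinear_linear:
  fixes q :: "'a::real_vector \<Rightarrow> real"
  assumes q: "sublinear q" and min: "\<And>r. sublinear r \<Longrightarrow> r \<le> q \<Longrightarrow> r = q"
  shows "linear q"
proof -
  have add: "q (x + y) = q x + q y" for x y
  proof -
    obtain r where "sublinear r" "r \<le> q" "\<And>x. r x \<le> q (x + y) - q y"
      using sublinear_direction[OF q] by blast
    with min have "q x \<le> q (x + y) - q y" by metis
    then show ?thesis using sublinear_add[OF q, of x y] by simp
  qed
  have neg: "q (- x) = - q x" for x
    using add[of x "- x"] sublinear_zero[OF q] by simp
  have "q (t *\<^sub>R x) = t *\<^sub>R q x" for t x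
  proof (cases "t \<ge> 0")
    case False
    then have "q (- (t *\<^sub>R x)) = - t * q x"
      using sublinear_scale[OF q, of "- t" x] by simp
    then show ?thesis using neg[of "t *\<^sub>R x"] by simp
  qed (simp add: sublinear_scale[OF q])
  with add show ?thesis by (rule linearI)
qed

text \<open>
  A minimal sublinear function below \<open>p\<close> is linear; starting the descent from \<open>p'\<close>, which is minimal
  at \<open>- z\<close>, forces equality at \<open>z\<close>.
\<close>

theorem Hahn_Banach_sublinear:
  fixes p :: "'a::real_vector \<Rightarrow> real"
  assumes p: "sublinear p"
  obtains g where "linear g" "\<And>x. g x \<le> p x" "g z = p z"
proof -
  obtain p' where p': "sublinear p'" "p' \<le> p" and p'z: "\<And>x. p' x \<le> p (x + z) - p z"
    using sublinear_direction[OF p] by blast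
  let ?S = "{q. sublinear q \<and> q \<le> p'}"
  \<comment> \<open>Zorn's lemma yields maximal elements, so the order is reversed to obtain a
    minimal one.\<close>
  have "\<exists>m\<in>?S. \<forall>a\<in>?S. a \<le> m \<longrightarrow> a = m"
  proof (rule predicate_Zorn[where P = "\<lambda>q r. r \<le> q"])
    show "partial_order_on ?S (relation_of (\<lambda>q r. r \<le> q) ?S)"
      by (rule partial_order_on_relation_ofI) auto
  next
    fix C assume C: "C \<in> Chains (relation_of (\<lambda>q r. r \<le> q) ?S)"
    then have CS: "C \<subseteq> ?S" and ch: "\<And>q r. q \<in> C \<Longrightarrow> r \<in> C \<Longrightarrow> q \<le> r \<or> r \<le> q"
      by (auto simp: Chains_def relation_of_def)
    show "\<exists>u\<in>?S. \<forall>a\<in>C. u \<le> a"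
    proof (cases "C = {}")
      case True
      then show ?thesis using p'(1) by blast
    next
      case False
      have C': "\<And>q. q \<in> C \<Longrightarrow> sublinear q" "\<And>q. q \<in> C \<Longrightarrow> q \<le> p'"
        using CS by auto
      obtain r where r: "sublinear r" "\<And>q. q \<in> C \<Longrightarrow> r \<le> q"
        using sublinear_chain_lower_bound[OF False C' ch] by metis
      obtain q where "q \<in> C" using False by blast
      then have "r \<le> p'" using r(2) C'(2) order_trans by blast
      with r show ?thesis by blast
    qed
  qed
  then obtain g where g: "sublinear g" "g \<le> p'" and min: "\<And>r. sublinear r \<Longrightarrow> r \<le> g \<Longrightarrow> r = g"
    by (auto dest: order_trans)
  have lin: "linear g" by (rule minimal_sublinear_linear[OF g(1) min])
  have le: "g x \<le> p x" for x
    using g(2) p'(2) by (meson le_funD order_trans)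
  have "g (- z) \<le> - p z"
    using p'z[of "- z"] le_funD[OF g(2), of "- z"] sublinear_zero[OF p] by simp
  then have "p z \<le> g z" by (simp add: linear_neg[OF lin])
  with le[of z] have "g z = p z" by simp
  with lin le show ?thesis by (rule that)
qed

text \<open>The upper bound at \<open>x\<close> and at \<open>- x\<close> controls the absolute
  value, so the linear functional is continuous.\<close>

lemma Hahn_Banach_bounded:
  fixes p :: "'a::real_normed_vector \<Rightarrow> real"
  assumes "sublinear p" and bound: "\<And>x. p x \<le> c * norm x"
  obtains \<zeta> :: "'a \<Rightarrow>\<^sub>L real" where "\<And>x. blinfun_apply \<zeta> x \<le> p x" "blinfun_apply \<zeta> z = p z"
proof -
  obtain g where g: "linear g" "\<And>x. g x \<le> p x" "g z = p z"
    using Hahn_Banach_sublinear[OF assms(1), of z] by blast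
  have "bounded_linear g"
  proof (rule bounded_linear_intro)
    fix x
    show "norm (g x) \<le> norm x * c"
      using g(2)[of x] g(2)[of "- x"] bound[of x] bound[of "- x"] linear_neg[OF g(1), of x]
      by (simp add: abs_le_iff mult.commute)
  qed (simp_all add: linear_add[OF g(1)] linear_scale[OF g(1)])
  then have "blinfun_apply (Blinfun g) = g" by (rule bounded_linear_Blinfun_apply)
  then show ?thesis using that[of "Blinfun g"] g(2,3) by simp
qed

text \<open>The norm is sublinear, hence some functional attains it at \<open>x - y\<close>.\<close>

lemma dual_separates_points:
  fixes x y :: "'a::real_normed_vector"
  assumes "\<And>\<zeta> :: 'a \<Rightarrow>\<^sub>L real. blinfun_apply \<zeta> x = blinfun_apply \<zeta> y"
  shows "x = y"
proof -
  have "sublinear (norm :: 'a \<Rightarrow> real)"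
    by (simp add: sublinear_def norm_triangle_ineq)
  then obtain \<zeta> :: "'a \<Rightarrow>\<^sub>L real" where "blinfun_apply \<zeta> (x - y) = norm (x - y)"
    using Hahn_Banach_bounded[of norm 1 "x - y"] by auto
  then show ?thesis using assms[of \<zeta>] by (simp add: blinfun.diff_right)
qed

lemma reflexive_weak_cluster_point:
  fixes U :: "nat \<Rightarrow> 'a::real_normed_vector"
  assumes refl: "reflexive_space TYPE('a)" and "Bseq U"
  obtains l where "\<And>(\<zeta> :: 'a \<Rightarrow>\<^sub>L real) c.
    \<forall>\<^sub>F n in sequentially. blinfun_apply \<zeta> (U n) \<le> c \<Longrightarrow> blinfun_apply \<zeta> l \<le> c"
proof -
  obtain B where B: "\<And>n. norm (U n) \<le> B" using \<open>Bseq U\<close> by (metis BseqE)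
  define S where "S \<zeta> = {c. \<forall>\<^sub>F n in sequentially. blinfun_apply \<zeta> (U n) \<le> c}" for \<zeta> :: "'a \<Rightarrow>\<^sub>L real"
  \<comment> \<open>\<open>p \<zeta>\<close> is the upper limit of \<open>\<zeta> (U n)\<close>,
    written as the infimum of its eventual upper bounds.\<close>
  define p where "p \<zeta> = Inf (S \<zeta>)" for \<zeta>
  have bound: "\<bar>blinfun_apply \<zeta> (U n)\<bar> \<le> B * norm \<zeta>" for \<zeta> :: "'a \<Rightarrow>\<^sub>L real" and n
    using norm_blinfun[of \<zeta> "U n"] mult_left_mono[OF B norm_ge_zero[of \<zeta>], of n]
    by (simp add: mult.commute)
  have lb: "- (B * norm \<zeta>) \<le> c" if "c \<in> S \<zeta>" for c \<zeta>
  proof -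
    from that obtain n where "blinfun_apply \<zeta> (U n) \<le> c"
      unfolding S_def using eventually_happens'[OF sequentially_bot] by blast
    then show ?thesis using bound[of \<zeta> n] by linarith
  qed
  have B_in: "B * norm \<zeta> \<in> S \<zeta>" for \<zeta>
    unfolding S_def using bound[of \<zeta>] by (auto simp: abs_le_iff)
  have bdd: "bdd_below (S \<zeta>)" for \<zeta> using lb by (rule bdd_belowI)
  have lower: "p \<zeta> \<le> c" if "c \<in> S \<zeta>" for c \<zeta>
    unfolding p_def using that bdd by (rule cInf_lower)
  have greatest: "c \<le> p \<zeta>" if "\<And>d. d \<in> S \<zeta> \<Longrightarrow> c \<le> d" for c \<zeta>
    unfolding p_def using B_in that by (intro cInf_greatest) blast+
  have "p (\<zeta> + \<xi>) \<le> p \<zeta> + p \<xi>" for \<zeta> \<xi>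
  proof -
    have *: "p (\<zeta> + \<xi>) \<le> c + d" if "c \<in> S \<zeta>" "d \<in> S \<xi>" for c d
    proof (rule lower)
      from that have "\<forall>\<^sub>F n in sequentially. blinfun_apply \<zeta> (U n) \<le> c \<and> blinfun_apply \<xi> (U n) \<le> d"
        by (simp add: S_def eventually_conj_iff)
      then show "c + d \<in> S (\<zeta> + \<xi>)"
        unfolding S_def by (auto elim!: eventually_mono simp: blinfun.add_left)
    qed
    have "p (\<zeta> + \<xi>) - c \<le> p \<xi>" if "c \<in> S \<zeta>" for c
      by (rule greatest) (use *[OF that] in \<open>simp add: algebra_simps\<close>)
    then have "p (\<zeta> + \<xi>) - p \<xi> \<le> p \<zeta>"
      by (intro greatest) (simp add: algebra_simps)
    then show ?thesis by simp
  qed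
  moreover have "p (t *\<^sub>R \<zeta>) \<le> t * p \<zeta>" if t: "t \<ge> 0" for t \<zeta>
  proof (cases "t = 0")
    case True
    then show ?thesis using lower[OF B_in, of 0] by simp
  next
    case False
    then have "t > 0" using t by simp
    have "p (t *\<^sub>R \<zeta>) / t \<le> p \<zeta>"
    proof (rule greatest)
      fix d assume "d \<in> S \<zeta>"
      then have "t * d \<in> S (t *\<^sub>R \<zeta>)"
        unfolding S_def using \<open>t > 0\<close>
        by (auto elim!: eventually_mono simp: blinfun.scaleR_left)
      from lower[OF this] show "p (t *\<^sub>R \<zeta>) / t \<le> d" using \<open>t > 0\<close> by (simp add: field_simps)
    qed
    then show ?thesis using \<open>t > 0\<close> by (simp add: field_simps)
  qed
  ultimately have "sublinear p" by (simp add: sublinear_def)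
  moreover have "p \<zeta> \<le> B * norm \<zeta>" for \<zeta> using lower[OF B_in] .
  ultimately obtain F :: "('a \<Rightarrow>\<^sub>L real) \<Rightarrow>\<^sub>L real" where F: "\<And>\<zeta>. blinfun_apply F \<zeta> \<le> p \<zeta>"
    using Hahn_Banach_bounded[of p B] by blast
  obtain l where "\<And>\<zeta>. blinfun_apply F \<zeta> = blinfun_apply \<zeta> l"
    using refl unfolding reflexive_space_def by blast
  then have "blinfun_apply \<zeta> l \<le> c" if "\<forall>\<^sub>F n in sequentially. blinfun_apply \<zeta> (U n) \<le> c"
    for \<zeta> :: "'a \<Rightarrow>\<^sub>L real" and c
    using F[of \<zeta>] lower[of c \<zeta>] that by (simp add: S_def)
  then show ?thesis by (rule that)
qed

subsection \<open>Convex functions and the Clarke derivative\<close>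

text \<open>Sublevel sets are closed by lower semicontinuity and exhaust the space, so by Baire one
  of them contains a ball. Convexity carries the upper bound on this ball to a neighbourhood of
  every point, and local boundedness of a convex function gives continuity.\<close>

lemma convex_lsc_continuous:
  fixes g :: "'a::banach \<Rightarrow> real"
  assumes cvx: "convex_on UNIV g" and lsc: "lower_semicontinuous g"
  shows "continuous_on UNIV g"
proof -
  have closed: "closed {x. g x \<le> c}" for c
  proof -
    have "open {x. c < g x}"
    proof (rule topological_space_class.openI)
      fix x assume "x \<in> {x. c < g x}"
      then have "ereal c < Liminf (nhds x) (\<lambda>y. ereal (g y))"
        using lsc unfolding lower_semicontinuous_def
        by (metis mem_Collect_eq less_le_trans less_ereal.simps(1))
      from less_LiminfD[OF this] obtain T where "open T" "x \<in> T" "\<forall>y\<in>T. c < g y"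
        by (auto simp: eventually_nhds)
      then show "\<exists>T. open T \<and> x \<in> T \<and> T \<subseteq> {x. c < g x}" by (intro exI[of _ T]) auto
    qed
    then show ?thesis by (simp add: closed_def Collect_neg_eq[symmetric] not_le)
  qed
  obtain N :: nat and x0 r where r: "r > 0" "ball x0 r \<subseteq> {x. g x \<le> real N}"
  proof -
    have "\<exists>N::nat. interior {x. g x \<le> real N} \<noteq> {}"
    proof (rule ccontr)
      assume "\<not> ?thesis"
      then have "interior (\<Union>(range (\<lambda>N::nat. {x. g x \<le> real N}))) = {}"
        using Met_TC.metric_Baire_category_alt[where 'a = 'a, of "range (\<lambda>N::nat. {x. g x \<le> real N})"]
          closed by (auto simp: mtopology_is_euclidean complete_UNIV)
      moreover have "\<Union>(range (\<lambda>N::nat. {x. g x \<le> real N})) = UNIV"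
        using real_arch_simple by (auto simp: set_eq_iff)
      ultimately show False by simp
    qed
    then show ?thesis using that by (auto simp: mem_interior)
  qed
  have "continuous (at z) g" for z
  proof -
    txt \<open>Points near \<open>z\<close> are midpoints of a point of \<open>ball x0 r\<close> and the reflection \<open>w\<close> of \<open>x0\<close> in \<open>z\<close>.\<close>
    define w where "w = 2 *\<^sub>R z - x0"
    define b where "b = (real N + g w) / 2"
    have upper: "g y \<le> b" if "y \<in> cball z (r / 4)" for y
    proof -
      define y' where "y' = 2 *\<^sub>R y - w"
      have "y' - x0 = 2 *\<^sub>R (y - z)" by (simp add: y'_def w_def algebra_simps)
      then have "norm (y' - x0) < r"
        using that r(1) by (simp add: dist_norm norm_minus_commute)
      then have "g y' \<le> real N" using r(2) by (auto simp: dist_norm norm_minus_commute)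
      moreover have "g y \<le> (1/2) * g y' + (1/2) * g w"
      proof -
        have "y = (1 - 1/2) *\<^sub>R y' + (1/2) *\<^sub>R w" by (simp add: y'_def scaleR_right_diff_distrib)
        then show ?thesis using convex_onD[OF cvx, of "1/2" y' w] by simp
      qed
      ultimately show ?thesis by (simp add: b_def)
    qed
    \<comment> \<open>An upper bound on a ball around \<open>z\<close> also yields a lower bound, by
      convexity between \<open>y\<close> and its reflection in \<open>z\<close>.\<close>
    have "\<forall>y\<in>ball z (r/4). \<bar>g y\<bar> \<le> b + 2 * \<bar>g z\<bar>"
    proof
      fix y assume "y \<in> ball z (r/4)"
      moreover have "convex_on (cball z (r/4)) g" using cvx by (rule convex_on_subset) auto
      ultimately show "\<bar>g y\<bar> \<le> b + 2 * \<bar>g z\<bar>"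
        using convex_bounds_lemma[of z "r/4" g b y] upper by auto
    qed
    then have "continuous_on (ball z (r/4)) g"
      using convex_on_subset[OF cvx] by (intro convex_on_bounded_continuous) auto
    then show ?thesis
      using r(1) by (simp add: continuous_on_eq_continuous_at)
  qed
  then show ?thesis by (simp add: continuous_at_imp_continuous_on)
qed

text \<open>Near \<open>x\<close> continuity gives the bound \<open>g x - 1\<close>; farther away,
  convexity on the segment from \<open>x\<close> limits the decrease to slope \<open>1 / d\<close>.
  This controls \<open>\<phi> (\<gamma>\<phi> u)\<close> from below in the a priori bound.\<close>

lemma convex_affine_lower_bound:
  fixes g :: "'a::real_normed_vector \<Rightarrow> real"
  assumes cvx: "convex_on UNIV g" and cont: "continuous_on UNIV g"
  obtains D where "D \<ge> 0" "\<And>z. g z \<ge> g x - 1 - D * norm (z - x)"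
proof -
  obtain d where d: "d > 0" "\<And>y. dist y x \<le> d \<Longrightarrow> \<bar>g y - g x\<bar> < 1"
  proof -
    obtain e where "e > 0" "\<And>y. dist y x < e \<Longrightarrow> dist (g y) (g x) < 1"
      using cont unfolding continuous_on_iff by (metis UNIV_I zero_less_one)
    then show ?thesis using that[of "e / 2"] by (auto simp: dist_real_def)
  qed
  have "g z \<ge> g x - 1 - (1 / d) * norm (z - x)" for z
  proof (cases "norm (z - x) \<le> d")
    case True
    then have "g z \<ge> g x - 1" using d(2)[of z] by (auto simp: dist_norm)
    moreover have "(1 / d) * norm (z - x) \<ge> 0" using d(1) by simp
    ultimately show ?thesis by linarith
  next
    case False
    \<comment> \<open>This \<open>t\<close> puts \<open>w\<close> at distance exactly
      \<open>d\<close> from \<open>x\<close>.\<close>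
    define t where "t = d / norm (z - x)"
    have n: "norm (z - x) > 0" using False d(1) by linarith
    then have t: "0 < t" "t \<le> 1"
      using False d(1) by (auto simp: t_def divide_le_eq)
    define w where "w = (1 - t) *\<^sub>R x + t *\<^sub>R z"
    have "w - x = t *\<^sub>R (z - x)" by (simp add: w_def algebra_simps)
    then have "norm (w - x) = d" using n d(1) by (simp add: t_def)
    then have "g w > g x - 1" using d(2)[of w] by (auto simp: dist_norm)
    moreover have "g w \<le> (1 - t) * g x + t * g z"
      unfolding w_def using convex_onD[OF cvx, of t x z] t by auto
    ultimately have "t * g x - 1 < t * g z" by (simp add: algebra_simps)
    then have "g x - 1 / t < g z" using t by (simp add: field_simps)
    moreover have "1 / t = (1 / d) * norm (z - x)" by (simp add: t_def)
    ultimately show ?thesis by linarith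
  qed
  then show ?thesis using that[of "1 / d"] d(1) by simp
qed

section \<open>Estimates for the Clarke directional derivative\<close>

lemma clarke_deriv_le:
  assumes "locally_lipschitz g"
    and "\<forall>\<^sub>F (y, t) in nhds x \<times>\<^sub>F at_right 0. (g (y + t *\<^sub>R v) - g y) / t \<le> a"
  shows "clarke_deriv g x v \<le> a"
proof -
  have "ereal (clarke_deriv g x v) \<le> ereal a"
    unfolding clarke_deriv_ereal[OF assms(1)]
    by (rule Limsup_bounded) (use assms(2) in eventually_elim, auto)
  then show ?thesis by simp
qed

lemma clarke_deriv_lessD:
  assumes "locally_lipschitz g" and "clarke_deriv g x v < a"
  shows "\<forall>\<^sub>F (y, t) in nhds x \<times>\<^sub>F at_right 0. (g (y + t *\<^sub>R v) - g y) / t < a"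
proof -
  have "ereal (clarke_deriv g x v) < ereal a" using assms(2) by simp
  from Limsup_lessD[OF this[unfolded clarke_deriv_ereal[OF assms(1)]]]
  show ?thesis by eventually_elim auto
qed

lemma clarke_deriv_zero: "clarke_deriv g x 0 = 0"
proof -
  have "Limsup (nhds x \<times>\<^sub>F at_right (0::real)) (\<lambda>_. 0 :: ereal) = 0"
    by (rule Limsup_const) (simp add: prod_filter_eq_bot)
  then show ?thesis by (simp add: clarke_deriv_def case_prod_unfold zero_ereal_def[symmetric])
qed

text \<open>The difference quotients in directions \<open>v\<close> and \<open>w\<close> share the
  base point, and their end points are \<open>t * norm (v - w)\<close> apart and eventually in
  \<open>S\<close>; the factor \<open>t\<close> cancels.\<close>

lemma clarke_deriv_direction_lipschitz:
  fixes g :: "'a::real_normed_vector \<Rightarrow> real"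
  assumes loc: "locally_lipschitz g" and S: "open S" "x \<in> S" and L: "L-lipschitz_on S g"
  shows "clarke_deriv g x v \<le> clarke_deriv g x w + L * norm (v - w)"
proof (rule field_le_epsilon)
  fix e :: real assume "e > 0"
  let ?F = "nhds x \<times>\<^sub>F at_right (0::real)"
  have in_S: "\<forall>\<^sub>F p in ?F. fst p + snd p *\<^sub>R d \<in> S" for d
  proof -
    have "((\<lambda>(y, t). y + t *\<^sub>R d) \<longlongrightarrow> x + 0 *\<^sub>R d) ?F"
      unfolding case_prod_beta
      by (intro tendsto_intros filterlim_compose[OF _ filterlim_fst] filterlim_compose[OF _ filterlim_snd])
         (auto intro: tendsto_ident_at filterlim_ident)
    then show ?thesis
      using S by (auto simp: case_prod_beta dest: topological_tendstoD[where S = S])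
  qed
  have "\<forall>\<^sub>F p in ?F. snd p > 0"
    unfolding eventually_prod_filter
    by (rule exI[of _ "\<lambda>_. True"], rule exI[of _ "\<lambda>t. t > 0"]) (auto simp: eventually_at_right_less)
  moreover have "\<forall>\<^sub>F (y, t) in ?F. (g (y + t *\<^sub>R w) - g y) / t < clarke_deriv g x w + e"
    using \<open>e > 0\<close> by (intro clarke_deriv_lessD[OF loc]) simp
  ultimately have "\<forall>\<^sub>F (y, t) in ?F. (g (y + t *\<^sub>R v) - g y) / t \<le> clarke_deriv g x w + e + L * norm (v - w)"
    using in_S[of v] in_S[of w]
  proof eventually_elim
    case (elim p)
    obtain y t where p: "p = (y, t)" by (cases p)
    with elim have t: "t > 0" by simp
    have "g (y + t *\<^sub>R v) - g (y + t *\<^sub>R w) \<le> L * dist (y + t *\<^sub>R v) (y + t *\<^sub>R w)"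
      using lipschitz_onD[OF L, of "y + t *\<^sub>R v" "y + t *\<^sub>R w"] elim p by (simp add: dist_real_def)
    also have "\<dots> = t * (L * norm (v - w))"
      using t by (simp add: dist_norm scaleR_diff_right[symmetric])
    finally have "(g (y + t *\<^sub>R v) - g y) / t \<le> (g (y + t *\<^sub>R w) - g y) / t + L * norm (v - w)"
      using t by (simp add: field_simps)
    then show ?case using elim p by simp
  qed
  then show "clarke_deriv g x v \<le> clarke_deriv g x w + L * norm (v - w) + e"
    by (intro clarke_deriv_le[OF loc]) (simp add: algebra_simps)
qed

text \<open>A bound \<open>b\<close> on the quotients near \<open>x0\<close> survives a small move
  of the base point. Changing the direction costs \<open>L * norm (v n - v0)\<close>, which
  eventually fits into the gap \<open>a - b\<close>.\<close>

lemma clarke_deriv_upper_semicontinuous: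
  fixes g :: "'a::real_normed_vector \<Rightarrow> real"
  assumes loc: "locally_lipschitz g" and x: "x \<longlonglongrightarrow> x0" and v: "v \<longlonglongrightarrow> v0"
    and a: "clarke_deriv g x0 v0 < a"
  shows "\<forall>\<^sub>F n in sequentially. clarke_deriv g (x n) (v n) < a"
proof -
  obtain r L where r: "r > 0" and L: "L-lipschitz_on (ball x0 r) g"
    using loc unfolding locally_lipschitz_def by blast
  obtain b where b: "clarke_deriv g x0 v0 < b" "b < a" using dense[OF a] by blast
  obtain Q R where Q: "eventually Q (nhds x0)" and R: "eventually R (at_right (0::real))"
    and QR: "\<And>y t. Q y \<Longrightarrow> R t \<Longrightarrow> (g (y + t *\<^sub>R v0) - g y) / t < b"
    using clarke_deriv_lessD[OF loc b(1)] unfolding eventually_prod_filter by auto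
  have "clarke_deriv g y v0 \<le> b" if "eventually Q (nhds y)" for y
    by (rule clarke_deriv_le[OF loc])
       (use that R QR in \<open>auto simp: eventually_prod_filter intro!: exI[of _ Q] exI[of _ R] less_imp_le\<close>)
  \<comment> \<open>A neighbourhood of \<open>x0\<close> is also a neighbourhood of all points close
    to \<open>x0\<close>.\<close>
  with Q have "\<forall>\<^sub>F y in nhds x0. clarke_deriv g y v0 \<le> b"
    by (subst (asm) eventually_eventually[symmetric]) (auto elim: eventually_mono)
  with x have "\<forall>\<^sub>F n in sequentially. clarke_deriv g (x n) v0 \<le> b"
    by (auto simp: filterlim_iff)
  moreover have "\<forall>\<^sub>F n in sequentially. x n \<in> ball x0 r"
    using x r by (intro topological_tendstoD) auto
  moreover have "(\<lambda>n. L * norm (v n - v0)) \<longlonglongrightarrow> L * norm (v0 - v0)"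
    by (intro tendsto_intros v)
  then have "\<forall>\<^sub>F n in sequentially. L * norm (v n - v0) < a - b"
    using b by (intro order_tendstoD) auto
  ultimately show ?thesis
  proof eventually_elim
    case (elim n)
    then show ?case
      using clarke_deriv_direction_lipschitz[OF loc open_ball elim(2) L, of "v n" v0] by linarith
  qed
qed

subsection \<open>Sequences of penalized solutions\<close>

lemma compact_operator_subsequence:
  assumes "compact_operator T" and "Bseq U"
  obtains r z where "strict_mono (r :: nat \<Rightarrow> nat)" "(\<lambda>n. T (U (r n))) \<longlonglongrightarrow> z"
proof -
  have "compact (closure (T ` range U))"
    using assms unfolding compact_operator_def by (simp add: Bseq_eq_bounded)
  moreover have "\<forall>n. T (U n) \<in> closure (T ` range U)"
    by (auto intro: closure_subset[THEN subsetD])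
  ultimately obtain z r where "strict_mono (r :: nat \<Rightarrow> nat)" "((\<lambda>n. T (U n)) \<circ> r) \<longlonglongrightarrow> z"
    unfolding compact_eq_seq_compact_metric seq_compact_def by metis
  then show ?thesis using that by (simp add: o_def)
qed

lemma bounded_operator_Bseq:
  assumes "bounded_operator T" and "Bseq U"
  shows "Bseq (\<lambda>n. T (U n))"
  using assms by (simp add: bounded_operator_def Bseq_eq_bounded image_image[symmetric, of T U])

text \<open>Evaluation at \<open>v\<close> is an element of the bidual, against which weak
  convergence in the dual is tested.\<close>

lemma weakly_converges_dual_apply:
  fixes \<zeta> :: "nat \<Rightarrow> 'a::real_normed_vector \<Rightarrow>\<^sub>L real"
  assumes "weakly_converges \<zeta> \<xi>"
  shows "(\<lambda>n. \<zeta> n v) \<longlonglongrightarrow> \<xi> v"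
proof -
  define ev where "ev = Blinfun (\<lambda>\<zeta> :: 'a \<Rightarrow>\<^sub>L real. \<zeta> v)"
  have "blinfun_apply ev = (\<lambda>\<zeta>. \<zeta> v)"
    unfolding ev_def by (rule bounded_linear_Blinfun_apply) (rule blinfun.bounded_linear_left)
  moreover have "(\<lambda>n. blinfun_apply ev (\<zeta> n)) \<longlonglongrightarrow> blinfun_apply ev \<xi>"
    using assms by (simp add: weakly_converges_def)
  ultimately show ?thesis by simp
qed

lemma Bseq_bound:
  assumes "Bseq U"
  obtains B where "B > 0" "\<And>n. norm (U n) \<le> B"
  using assms by (metis BseqE)

text \<open>Functionals on the target, composed with \<open>T\<close>, are functionals on the
  domain, so the cluster property applies to them with both signs. This identifies the limits
  produced by compactness.\<close>

lemma weak_cluster_image: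
  fixes T :: "'a::real_normed_vector \<Rightarrow>\<^sub>L 'b::real_normed_vector"
  assumes l: "\<And>(\<zeta> :: 'a \<Rightarrow>\<^sub>L real) c. \<forall>\<^sub>F n in sequentially. \<zeta> (U n) \<le> c \<Longrightarrow> \<zeta> l \<le> c"
    and lim: "(\<lambda>n. T (U n)) \<longlonglongrightarrow> z"
  shows "z = T l"
proof (rule dual_separates_points)
  have le: "\<zeta> (T l) \<le> \<zeta> z" for \<zeta> :: "'b \<Rightarrow>\<^sub>L real"
  proof (rule field_le_epsilon)
    fix \<epsilon> :: real assume "\<epsilon> > 0"
    have "(\<lambda>n. \<zeta> (T (U n))) \<longlonglongrightarrow> \<zeta> z" by (intro tendsto_intros lim)
    then have "\<forall>\<^sub>F n in sequentially. \<zeta> (T (U n)) < \<zeta> z + \<epsilon>"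
      using \<open>\<epsilon> > 0\<close> by (intro order_tendstoD) auto
    then have "\<forall>\<^sub>F n in sequentially. (\<zeta> o\<^sub>L T) (U n) \<le> \<zeta> z + \<epsilon>"
      by eventually_elim simp
    from l[OF this] show "\<zeta> (T l) \<le> \<zeta> z + \<epsilon>" by simp
  qed
  show "\<zeta> z = \<zeta> (T l)" for \<zeta> :: "'b \<Rightarrow>\<^sub>L real"
    using le[of \<zeta>] le[of "- \<zeta>"] by (simp add: blinfun.minus_left)
qed

lemma quadratic_le_affine_imp_bounded:
  fixes d :: real
  assumes \<delta>: "\<delta> > 0" and d: "d \<ge> 0" and le: "\<delta> * d\<^sup>2 \<le> a + b * d"
  shows "d \<le> 1 + (\<bar>a\<bar> + \<bar>b\<bar>) / \<delta>"
proof (cases "d \<le> 1")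
  case True
  moreover have "(\<bar>a\<bar> + \<bar>b\<bar>) / \<delta> \<ge> 0" using \<delta> by simp
  ultimately show ?thesis by linarith
next
  case False
  have "a \<le> \<bar>a\<bar> * d" using False mult_left_mono[of 1 d "\<bar>a\<bar>"] by linarith
  moreover have "b * d \<le> \<bar>b\<bar> * d" using d by (intro mult_right_mono) auto
  ultimately have "(\<delta> * d) * d \<le> (\<bar>a\<bar> + \<bar>b\<bar>) * d"
    using le by (simp add: power2_eq_square algebra_simps)
  then have "\<delta> * d \<le> \<bar>a\<bar> + \<bar>b\<bar>" using False by simp
  then have "d \<le> (\<bar>a\<bar> + \<bar>b\<bar>) / \<delta>" using \<delta> by (simp add: field_simps)
  then show ?thesis by simp
qed

text \<open>
  A sequence of solutions of the penalized problems on the subspaces \<open>V n\<close> with penalty parameters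
  \<open>e n\<close>.
\<close>

locale penalized_sequence =
  fixes K :: "'x::banach set"
    and \<gamma>\<phi> :: "'x \<Rightarrow>\<^sub>L 'p::banach"
    and \<gamma>j :: "'x \<Rightarrow>\<^sub>L 'j::banach"
    and A P :: "'x \<Rightarrow> ('x \<Rightarrow>\<^sub>L real)"
    and \<phi> :: "'p \<Rightarrow> 'p \<Rightarrow> real"
    and j :: "'j \<Rightarrow> real"
    and f :: "'x \<Rightarrow>\<^sub>L real"
    and c\<phi> cj mA \<alpha>\<phi> \<alpha>j :: real
    and u :: 'x
    and V :: "nat \<Rightarrow> 'x set"
    and e :: "nat \<Rightarrow> real"
    and U :: "nat \<Rightarrow> 'x"
  assumes reflexive: "reflexive_space TYPE('x)"
    and c\<phi>: "c\<phi> > 0" "\<And>v. norm (\<gamma>\<phi> v) \<le> c\<phi> * norm v"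
    and cj: "cj > 0" "\<And>v. norm (\<gamma>j v) \<le> cj * norm v"
    and A_bounded: "bounded_operator A"
    and A_mono: "\<And>v w. (A v - A w) (v - w) \<ge> mA * (norm (v - w))\<^sup>2"
    and mA: "mA > 0"
    and \<phi>_convex: "\<And>z. convex_on UNIV (\<phi> z)"
    and \<phi>_lsc: "\<And>z. lower_semicontinuous (\<phi> z)"
    and \<alpha>\<phi>: "\<alpha>\<phi> \<ge> 0"
    and \<phi>_le: "\<And>z1 z2 z3 z4. \<phi> z1 z4 - \<phi> z1 z3 + \<phi> z2 z3 - \<phi> z2 z4
         \<le> \<alpha>\<phi> * norm (z1 - z2) * norm (z3 - z4)"
    and j_lip: "locally_lipschitz j"
    and \<alpha>j: "\<alpha>j \<ge> 0"
    and j_le: "\<And>z1 z2. clarke_deriv j z1 (z2 - z1) + clarke_deriv j z2 (z1 - z2)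
         \<le> \<alpha>j * (norm (z1 - z2))\<^sup>2"
    and small: "\<alpha>\<phi> * c\<phi>\<^sup>2 + \<alpha>j * cj\<^sup>2 < mA"
    and compact: "compact_operator \<gamma>\<phi>" "compact_operator \<gamma>j"
    and P: "penalty_operator P K"
    and u_K: "u \<in> K"
    and u_solves: "\<And>v. v \<in> K \<Longrightarrow> A u (v - u) + \<phi> (\<gamma>\<phi> u) (\<gamma>\<phi> v) - \<phi> (\<gamma>\<phi> u) (\<gamma>\<phi> u)
          + clarke_deriv j (\<gamma>j u) (\<gamma>j v - \<gamma>j u) \<ge> f (v - u)"
    and V_dense: "\<And>v. \<exists>v'. (\<forall>n. v' n \<in> V n) \<and> v' \<longlonglongrightarrow> v"
    and V_dense_K: "\<And>v. v \<in> K \<Longrightarrow> \<exists>v'. (\<forall>n. v' n \<in> V n \<inter> K) \<and> v' \<longlonglongrightarrow> v"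
    and e_pos: "\<And>n. e n > 0"
    and e_tendsto: "e \<longlonglongrightarrow> 0"
    and U_solves: "\<And>n v. v \<in> V n \<Longrightarrow> A (U n) (v - U n) + (1 / e n) * P (U n) (v - U n)
          + \<phi> (\<gamma>\<phi> (U n)) (\<gamma>\<phi> v) - \<phi> (\<gamma>\<phi> (U n)) (\<gamma>\<phi> (U n))
          + clarke_deriv j (\<gamma>j (U n)) (\<gamma>j v - \<gamma>j (U n)) \<ge> f (v - U n)"
begin

text \<open>The index map need only tend to infinity; the indices chosen in
  \<open>comes_close\<close> are not known to be increasing.\<close>

lemma subsequence:
  assumes r: "filterlim r sequentially sequentially"
  shows "penalized_sequence K \<gamma>\<phi> \<gamma>j A P \<phi> j f c\<phi> cj mA \<alpha>\<phi> \<alpha>j u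
    (\<lambda>n. V (r n)) (\<lambda>n. e (r n)) (\<lambda>n. U (r n))"
proof unfold_locales
  fix v
  show "\<exists>v'. (\<forall>n. v' n \<in> V (r n)) \<and> v' \<longlonglongrightarrow> v"
  proof -
    obtain v' where "\<forall>n. v' n \<in> V n" "v' \<longlonglongrightarrow> v" using V_dense by blast
    then show ?thesis
      using filterlim_compose[of v' "nhds v", OF _ r] by (intro exI[of _ "\<lambda>n. v' (r n)"]) simp
  qed
  show "\<exists>v'. (\<forall>n. v' n \<in> V (r n) \<inter> K) \<and> v' \<longlonglongrightarrow> v" if v: "v \<in> K"
  proof -
    obtain v' where "\<forall>n. v' n \<in> V n \<inter> K" "v' \<longlonglongrightarrow> v" using V_dense_K[OF v] by blast
    then show ?thesis
      using filterlim_compose[of v' "nhds v", OF _ r] by (intro exI[of _ "\<lambda>n. v' (r n)"]) simp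
  qed
  show "(\<lambda>n. e (r n)) \<longlonglongrightarrow> 0"
    using e_tendsto r by (rule filterlim_compose)
qed (rule reflexive c\<phi> cj A_bounded A_mono mA \<phi>_convex \<phi>_lsc \<alpha>\<phi> \<phi>_le j_lip \<alpha>j j_le small compact P u_K
    e_pos | erule u_solves U_solves)+

section \<open>Test inequalities and the a priori bound\<close>

lemma P_bounded: "bounded_operator P"
  and P_demicontinuous: "demicontinuous P"
  and P_mono: "(P v - P w) (v - w) \<ge> 0"
  and P_zero_iff: "P v = 0 \<longleftrightarrow> v \<in> K"
  using P unfolding penalty_operator_def monotone_operator_def by auto

lemma \<phi>_continuous: "continuous_on UNIV (\<phi> z)"
  using \<phi>_convex \<phi>_lsc by (rule convex_lsc_continuous)

lemma \<phi>_tendsto: "x \<longlonglongrightarrow> x0 \<Longrightarrow> (\<lambda>n. \<phi> z (x n)) \<longlonglongrightarrow> \<phi> z x0"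
  using continuous_on_tendsto_compose[OF \<phi>_continuous] by force

text \<open>Fixes the first argument of \<open>\<phi>\<close>, since continuity is available in the second argument only.\<close>

lemma \<phi>_freeze:
  "\<phi> x y - \<phi> x x \<le> \<phi> z y - \<phi> z x + \<alpha>\<phi> * norm (x - z) * norm (x - y)"
  using \<phi>_le[of x y x z] by simp

lemma test_K:
  assumes "v \<in> V n" "v \<in> K"
  shows "A (U n) (U n - v) \<le> \<phi> (\<gamma>\<phi> (U n)) (\<gamma>\<phi> v) - \<phi> (\<gamma>\<phi> (U n)) (\<gamma>\<phi> (U n))
      + clarke_deriv j (\<gamma>j (U n)) (\<gamma>j v - \<gamma>j (U n)) + f (U n - v)"
proof -
  have "P (U n) (v - U n) \<le> 0"
    using P_mono[of "U n" v] P_zero_iff[of v] assms(2)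
    by (simp add: blinfun.diff_left blinfun.diff_right)
  then have "(1 / e n) * P (U n) (v - U n) \<le> 0"
    using e_pos[of n] by (simp add: mult_le_0_iff divide_le_0_iff)
  then show ?thesis
    using U_solves[OF assms(1)] by (simp add: blinfun.diff_right)
qed

text \<open>Testing with points of \<open>V n \<inter> K\<close> that approximate \<open>u\<close>
  and using strong monotonicity gives a quadratic inequality for \<open>norm (U n - v n)\<close>, in
  which the smallness condition keeps the leading coefficient positive.\<close>

lemma bounded: "Bseq U"
proof -
  obtain v where v: "\<And>n. v n \<in> V n" "\<And>n. v n \<in> K" "v \<longlonglongrightarrow> u"
    using V_dense_K[OF u_K] by auto
  have Bv: "Bseq v" using v(3) by (rule convergentI[THEN convergent_imp_Bseq])
  obtain BA where BA: "\<And>n. norm (A (v n)) \<le> BA"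
    using bounded_operator_Bseq[OF A_bounded Bv] by (metis Bseq_bound)
  obtain Bv where Bv: "\<And>n. norm (v n) \<le> Bv" using Bv by (metis Bseq_bound)
  let ?g = "\<phi> (\<gamma>\<phi> u)"
  have "(\<lambda>n. ?g (\<gamma>\<phi> (v n))) \<longlonglongrightarrow> ?g (\<gamma>\<phi> u)"
    by (intro \<phi>_tendsto tendsto_intros v)
  then obtain Bg where Bg: "\<And>n. \<bar>?g (\<gamma>\<phi> (v n))\<bar> \<le> Bg"
    using convergentI[THEN convergent_imp_Bseq] by (metis Bseq_bound real_norm_def)
  obtain D where D: "D \<ge> 0" "\<And>z. ?g z \<ge> ?g (\<gamma>\<phi> u) - 1 - D * norm (z - \<gamma>\<phi> u)"
    using convex_affine_lower_bound[OF \<phi>_convex \<phi>_continuous] by blast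
  obtain r L where r: "r > 0" and L: "L-lipschitz_on (ball (\<gamma>j u) r) j"
    using j_lip unfolding locally_lipschitz_def by blast
  have "L \<ge> 0" using L by (rule lipschitz_on_nonneg)
  \<comment> \<open>What remains of \<open>mA\<close> after absorbing the quadratic contributions of
    \<open>\<phi>\<close> and \<open>j\<close>.\<close>
  define \<delta> where "\<delta> = mA - (\<alpha>\<phi> * c\<phi>\<^sup>2 + \<alpha>j * cj\<^sup>2)"
  have "\<delta> > 0" using small by (simp add: \<delta>_def)
  define Bd where "Bd = Bv + norm u"
  \<comment> \<open>\<open>a\<close> and \<open>b\<close> collect the constant and the linear terms
    of the final estimate in \<open>d\<close>.\<close>
  define a where "a = Bg - ?g (\<gamma>\<phi> u) + 1 + D * c\<phi> * Bd"
  define b where "b = BA + norm f + D * c\<phi> + \<alpha>\<phi> * c\<phi>\<^sup>2 * Bd + L * cj"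
  \<comment> \<open>The Lipschitz constant \<open>L\<close> of \<open>j\<close> is local, so the
    estimate holds only once \<open>\<gamma>j (v n)\<close> has entered the ball.\<close>
  have "(\<lambda>n. \<gamma>j (v n)) \<longlonglongrightarrow> \<gamma>j u" by (intro tendsto_intros v)
  then have "\<forall>\<^sub>F n in sequentially. \<gamma>j (v n) \<in> ball (\<gamma>j u) r"
    using r by (intro topological_tendstoD) auto
  then have "\<forall>\<^sub>F n in sequentially. norm (U n) \<le> 1 + (\<bar>a\<bar> + \<bar>b\<bar>) / \<delta> + Bv"
  proof eventually_elim
    case (elim n)
    define d where "d = norm (U n - v n)"
    have d0: "d \<ge> 0" by (simp add: d_def)
    have dU: "norm (U n - u) \<le> d + Bd"
    proof -
      have "norm (U n - u) \<le> d + norm (v n - u)"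
        unfolding d_def using norm_triangle_ineq[of "U n - v n" "v n - u"] by simp
      moreover have "norm (v n - u) \<le> Bd"
        using norm_triangle_ineq4[of "v n" u] Bv[of n] by (simp add: Bd_def)
      ultimately show ?thesis by linarith
    qed
    have n\<phi>: "norm (\<gamma>\<phi> (U n) - \<gamma>\<phi> x) \<le> c\<phi> * norm (U n - x)" for x
      using c\<phi>(2)[of "U n - x"] by (simp add: blinfun.diff_right)
    have nj: "norm (\<gamma>j (U n) - \<gamma>j (v n)) \<le> cj * d"
      using cj(2)[of "U n - v n"] by (simp add: blinfun.diff_right d_def)
    have \<phi>_part: "\<phi> (\<gamma>\<phi> (U n)) (\<gamma>\<phi> (v n)) - \<phi> (\<gamma>\<phi> (U n)) (\<gamma>\<phi> (U n))
      \<le> Bg - ?g (\<gamma>\<phi> u) + 1 + D * (c\<phi> * (d + Bd)) + \<alpha>\<phi> * (c\<phi> * (d + Bd)) * (c\<phi> * d)"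
    proof -
      have 1: "norm (\<gamma>\<phi> (U n) - \<gamma>\<phi> u) \<le> c\<phi> * (d + Bd)"
        using n\<phi>[of u] mult_left_mono[OF dU, of c\<phi>] c\<phi>(1) by linarith
      then have "D * norm (\<gamma>\<phi> (U n) - \<gamma>\<phi> u) \<le> D * (c\<phi> * (d + Bd))"
        using D(1) by (rule mult_left_mono)
      moreover have "\<alpha>\<phi> * norm (\<gamma>\<phi> (U n) - \<gamma>\<phi> u) * norm (\<gamma>\<phi> (U n) - \<gamma>\<phi> (v n))
          \<le> \<alpha>\<phi> * (c\<phi> * (d + Bd)) * (c\<phi> * d)"
      proof (rule mult_mono)
        show "0 \<le> \<alpha>\<phi> * (c\<phi> * (d + Bd))"
          using \<alpha>\<phi> 1 norm_ge_zero order_trans by (metis mult_nonneg_nonneg)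
      qed (use 1 n\<phi>[of "v n"] \<alpha>\<phi> in \<open>auto simp: d_def intro: mult_left_mono\<close>)
      ultimately show ?thesis
        using \<phi>_freeze[of "\<gamma>\<phi> (U n)" "\<gamma>\<phi> (v n)" "\<gamma>\<phi> u"] D(2)[of "\<gamma>\<phi> (U n)"] Bg[of n] by linarith
    qed
    \<comment> \<open>The base point \<open>\<gamma>j (U n)\<close> is not yet controlled.
      \<open>j_le\<close> trades it for \<open>\<gamma>j (v n)\<close>, where the derivative is
      bounded below by comparison with direction \<open>0\<close>.\<close>
    have j_part: "clarke_deriv j (\<gamma>j (U n)) (\<gamma>j (v n) - \<gamma>j (U n)) \<le> \<alpha>j * (cj * d)\<^sup>2 + L * (cj * d)"
    proof -
      let ?w = "\<gamma>j (U n) - \<gamma>j (v n)"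
      have "0 \<le> clarke_deriv j (\<gamma>j (v n)) ?w + L * norm (0 - ?w)"
        using clarke_deriv_direction_lipschitz[OF j_lip open_ball elim L, of 0 ?w]
        by (simp only: clarke_deriv_zero)
      then have "0 \<le> clarke_deriv j (\<gamma>j (v n)) ?w + L * norm ?w"
        by (simp only: norm_minus_cancel diff_0)
      moreover have "L * norm ?w \<le> L * (cj * d)"
        using nj \<open>L \<ge> 0\<close> by (rule mult_left_mono)
      moreover have "\<alpha>j * (norm ?w)\<^sup>2 \<le> \<alpha>j * (cj * d)\<^sup>2"
        using nj \<alpha>j by (intro mult_left_mono power_mono) auto
      ultimately show ?thesis
        using j_le[of "\<gamma>j (U n)" "\<gamma>j (v n)"] by linarith
    qed
    have "- A (v n) (U n - v n) \<le> BA * d"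
      using norm_blinfun[of "A (v n)" "U n - v n"] mult_right_mono[OF BA[of n] d0]
      by (auto simp: d_def)
    moreover have "f (U n - v n) \<le> norm f * d"
      using norm_blinfun[of f "U n - v n"] by (auto simp: d_def)
    moreover have "mA * d\<^sup>2 \<le> A (U n) (U n - v n) - A (v n) (U n - v n)"
      using A_mono[of "U n" "v n"] by (simp add: d_def blinfun.diff_left)
    ultimately have "mA * d\<^sup>2 \<le> BA * d + norm f * d
        + (Bg - ?g (\<gamma>\<phi> u) + 1 + D * (c\<phi> * (d + Bd)) + \<alpha>\<phi> * (c\<phi> * (d + Bd)) * (c\<phi> * d))
        + (\<alpha>j * (cj * d)\<^sup>2 + L * (cj * d))"
      using test_K[OF v(1,2)] \<phi>_part j_part by smt
    then have "\<delta> * d\<^sup>2 \<le> a + b * d"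
      by (simp add: \<delta>_def a_def b_def power2_eq_square algebra_simps)
    with \<open>\<delta> > 0\<close> d0 have "d \<le> 1 + (\<bar>a\<bar> + \<bar>b\<bar>) / \<delta>" by (rule quadratic_le_affine_imp_bounded)
    moreover have "norm (U n) \<le> d + norm (v n)"
      unfolding d_def using norm_triangle_ineq[of "U n - v n" "v n"] by simp
    ultimately show ?case using Bv[of n] by linarith
  qed
  then show ?thesis by (rule BfunI)
qed

lemma AU_bound:
  obtains B where "B > 0" "\<And>n w. \<bar>A (U n) w\<bar> \<le> B * norm w"
proof -
  obtain B where B: "B > 0" "\<And>n. norm (A (U n)) \<le> B"
    using bounded_operator_Bseq[OF A_bounded bounded] by (metis Bseq_bound)
  have "\<bar>A (U n) w\<bar> \<le> B * norm w" for n w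
    using norm_blinfun[of "A (U n)" w] mult_right_mono[OF B(2)[of n], of "norm w"] by simp
  with B(1) show ?thesis by (rule that)
qed

end

section \<open>Weak limits of penalized solutions\<close>

text \<open>\<open>weak\<close> asks less than weak convergence: with both signs it places
  \<open>\<zeta> l\<close> between the lower and upper limits of \<open>\<zeta> (U n)\<close>. Under
  the two compact operators the images converge strongly.\<close>

locale penalized_sequence_weak_limit = penalized_sequence +
  fixes l
  assumes weak: "\<And>\<zeta> (c :: real).
      \<forall>\<^sub>F n in sequentially. blinfun_apply \<zeta> (U n) \<le> c \<Longrightarrow> blinfun_apply \<zeta> l \<le> c"
    and \<gamma>\<phi>_tendsto: "(\<lambda>n. \<gamma>\<phi> (U n)) \<longlonglongrightarrow> \<gamma>\<phi> l"
    and \<gamma>j_tendsto: "(\<lambda>n. \<gamma>j (U n)) \<longlonglongrightarrow> \<gamma>j l"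
begin

text \<open>All terms of the inequality other than the penalty are bounded above along the sequence,
  so multiplying by \<open>e n\<close> leaves a penalty term of order \<open>e n\<close>. The test
  points need not lie in \<open>K\<close>.\<close>

lemma P_tested:
  assumes v: "\<And>n. v n \<in> V n" "v \<longlonglongrightarrow> w"
  obtains C where "\<forall>\<^sub>F n in sequentially. P (U n) (U n - v n) \<le> e n * C"
proof -
  let ?g = "\<phi> (\<gamma>\<phi> l)"
  obtain BA where BA: "BA > 0" "\<And>n w. \<bar>A (U n) w\<bar> \<le> BA * norm w" using AU_bound by blast
  have "Bseq v" using v(2) by (rule convergentI[THEN convergent_imp_Bseq])
  then obtain B1 B2 where "\<And>n. norm (v n) \<le> B1" "\<And>n. norm (U n) \<le> B2"
    using bounded by (metis Bseq_bound)
  then have B: "norm (v n - U n) \<le> B1 + B2" for n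
    using norm_triangle_ineq4[of "v n" "U n"] add_mono order_trans by blast
  define B where "B = B1 + B2"
  note B = B[folded B_def]
  have v_tendsto: "(\<lambda>n. \<gamma>\<phi> (v n)) \<longlonglongrightarrow> \<gamma>\<phi> w" "(\<lambda>n. \<gamma>j (v n)) \<longlonglongrightarrow> \<gamma>j w"
    by (intro tendsto_intros v)+
  let ?s = "\<lambda>n. ?g (\<gamma>\<phi> (v n)) - ?g (\<gamma>\<phi> (U n))
      + \<alpha>\<phi> * norm (\<gamma>\<phi> (U n) - \<gamma>\<phi> l) * norm (\<gamma>\<phi> (U n) - \<gamma>\<phi> (v n))"
  \<comment> \<open>\<open>s\<close> is the limit of the bound for the \<phi>-difference, and
    \<open>J\<close> bounds the upper limit of the Clarke derivatives; the added units are slack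
    that makes both bounds hold eventually.\<close>
  define s where "s = ?g (\<gamma>\<phi> w) - ?g (\<gamma>\<phi> l)"
  have "?s \<longlonglongrightarrow> ?g (\<gamma>\<phi> w) - ?g (\<gamma>\<phi> l) + \<alpha>\<phi> * norm (\<gamma>\<phi> l - \<gamma>\<phi> l) * norm (\<gamma>\<phi> l - \<gamma>\<phi> w)"
    by (intro tendsto_intros \<phi>_tendsto v_tendsto \<gamma>\<phi>_tendsto)
  then have "\<forall>\<^sub>F n in sequentially. ?s n < s + 1"
    by (rule order_tendstoD) (simp add: s_def)
  moreover define J where "J = clarke_deriv j (\<gamma>j l) (\<gamma>j w - \<gamma>j l)"
  have "\<forall>\<^sub>F n in sequentially. clarke_deriv j (\<gamma>j (U n)) (\<gamma>j (v n) - \<gamma>j (U n)) < J + 1"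
    by (rule clarke_deriv_upper_semicontinuous[OF j_lip \<gamma>j_tendsto])
       (auto intro!: tendsto_intros v_tendsto \<gamma>j_tendsto simp: J_def)
  ultimately have "\<forall>\<^sub>F n in sequentially. P (U n) (U n - v n) \<le> e n * (BA * B + norm f * B + (s + 1) + (J + 1))"
  proof eventually_elim
    case (elim n)
    have "A (U n) (v n - U n) \<le> BA * B"
      using BA(2)[of n "v n - U n"] mult_left_mono[OF B[of n], of BA] BA(1) by linarith
    moreover have "- f (v n - U n) \<le> norm f * B"
      using norm_blinfun[of f "v n - U n"] mult_left_mono[OF B[of n] norm_ge_zero[of f]] by simp
    ultimately have "- ((1 / e n) * P (U n) (v n - U n)) \<le> BA * B + norm f * B + (s + 1) + (J + 1)"
      using U_solves[OF v(1)[of n]] elim \<phi>_freeze[of "\<gamma>\<phi> (U n)" "\<gamma>\<phi> (v n)" "\<gamma>\<phi> l"] by linarith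
    then have "P (U n) (U n - v n) / e n \<le> BA * B + norm f * B + (s + 1) + (J + 1)"
      by (simp add: blinfun.diff_right diff_divide_distrib)
    then show ?case using e_pos[of n] by (simp add: field_simps)
  qed
  then show ?thesis by (rule that)
qed

text \<open>First half of Minty's trick: by monotonicity
  \<open>P w (U n - w) \<le> P (U n) (U n - w)\<close>. The right side splits at \<open>v n\<close>
  into a term of order \<open>e n\<close> and one bounded by \<open>B * norm (v n - w)\<close>. Then
  \<open>weak\<close> is applied to the single functional \<open>P w\<close>.\<close>

lemma P_variational: "P w (w - l) \<ge> 0"
proof -
  obtain v where v: "\<And>n. v n \<in> V n" "v \<longlonglongrightarrow> w" using V_dense by blast
  obtain C where C: "\<forall>\<^sub>F n in sequentially. P (U n) (U n - v n) \<le> e n * C"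
    using P_tested[OF v] by blast
  obtain B where B: "B > 0" "\<And>n. norm (P (U n)) \<le> B"
    using bounded_operator_Bseq[OF P_bounded bounded] by (metis Bseq_bound)
  have "P w l \<le> P w w + \<epsilon>" if "\<epsilon> > 0" for \<epsilon>
  proof (rule weak)
    have "(\<lambda>n. e n * C + B * norm (v n - w)) \<longlonglongrightarrow> 0 * C + B * norm (w - w)"
      by (intro tendsto_intros e_tendsto v)
    then have "\<forall>\<^sub>F n in sequentially. e n * C + B * norm (v n - w) < \<epsilon>"
      using that by (intro order_tendstoD) auto
    with C show "\<forall>\<^sub>F n in sequentially. P w (U n) \<le> P w w + \<epsilon>"
    proof eventually_elim
      case (elim n)
      have "P (U n) (v n - w) \<le> B * norm (v n - w)"
        using norm_blinfun[of "P (U n)" "v n - w"] mult_right_mono[OF B(2)[of n], of "norm (v n - w)"]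
        by simp
      with elim P_mono[of w "U n"] show ?case
        by (simp add: blinfun.diff_right blinfun.diff_left)
    qed
  qed
  then have "P w l \<le> P w w" by (rule field_le_epsilon)
  then show ?thesis by (simp add: blinfun.diff_right)
qed

text \<open>Second half of Minty's trick: take \<open>w = l + t v\<close>, divide by
  \<open>t\<close> and let \<open>t\<close> decrease to zero; demicontinuity gives
  \<open>P l v \<ge> 0\<close> for every \<open>v\<close>, hence \<open>P l = 0\<close>.\<close>

lemma l_in_K: "l \<in> K"
proof -
  have nonneg: "P l v \<ge> 0" for v
  proof -
    define w where "w n = l + inverse (real (Suc n)) *\<^sub>R v" for n
    have "w \<longlonglongrightarrow> l + 0 *\<^sub>R v"
      unfolding w_def by (intro tendsto_intros LIMSEQ_inverse_real_of_nat)
    then have "weakly_converges (\<lambda>n. P (w n)) (P l)"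
      using P_demicontinuous unfolding demicontinuous_def by simp
    then have "(\<lambda>n. P (w n) v) \<longlonglongrightarrow> P l v"
      by (rule weakly_converges_dual_apply)
    moreover have "P (w n) v \<ge> 0" for n
    proof -
      have "0 \<le> inverse (real (Suc n)) * P (w n) v"
        using P_variational[of "w n"] by (simp add: w_def blinfun.scaleR_right)
      then show ?thesis by (simp add: zero_le_mult_iff)
    qed
    ultimately show ?thesis by (intro LIMSEQ_le_const) auto
  qed
  have "P l v = 0" for v
    using nonneg[of v] nonneg[of "- v"] by (simp add: blinfun.minus_right)
  then have "P l = 0" by (intro blinfun_eqI) simp
  then show ?thesis by (simp add: P_zero_iff)
qed

text \<open>If \<open>U n\<close> stayed away from \<open>l\<close>, strong monotonicity would push
  \<open>(A l - f) (U n - l)\<close> below a fixed negative number, contradicting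
  \<open>weak\<close> for the functional \<open>A l - f\<close>. One-sided control yields closeness
  only infinitely often.\<close>

lemma frequently_close:
  assumes "\<epsilon> > 0"
  shows "\<exists>\<^sub>F n in sequentially. norm (U n - l) < \<epsilon>"
proof (rule ccontr)
  assume "\<not> ?thesis"
  then have far: "\<forall>\<^sub>F n in sequentially. \<epsilon> \<le> norm (U n - l)"
    by (simp add: not_frequently not_less)
  obtain v where v: "\<And>n. v n \<in> V n" "\<And>n. v n \<in> K" "v \<longlonglongrightarrow> l"
    using V_dense_K[OF l_in_K] by auto
  obtain BA where BA: "BA > 0" "\<And>n w. \<bar>A (U n) w\<bar> \<le> BA * norm w" using AU_bound by blast
  have v_tendsto: "(\<lambda>n. \<gamma>\<phi> (v n)) \<longlonglongrightarrow> \<gamma>\<phi> l" "(\<lambda>n. \<gamma>j (v n)) \<longlonglongrightarrow> \<gamma>j l"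
    by (intro tendsto_intros v)+
  \<comment> \<open>A quarter of the gain from monotonicity: one \<open>\<kappa>\<close> is spent on
    the Clarke derivative, one on the remaining errors, and two are left for the
    contradiction.\<close>
  define \<kappa> where "\<kappa> = mA * \<epsilon>\<^sup>2 / 4"
  have "\<kappa> > 0" using mA assms by (simp add: \<kappa>_def)
  let ?g = "\<phi> (\<gamma>\<phi> l)"
  let ?s = "\<lambda>n. ?g (\<gamma>\<phi> (v n)) - ?g (\<gamma>\<phi> (U n))
      + \<alpha>\<phi> * norm (\<gamma>\<phi> (U n) - \<gamma>\<phi> l) * norm (\<gamma>\<phi> (U n) - \<gamma>\<phi> (v n))
      + f (l - v n) + BA * norm (v n - l)"
  have "?s \<longlonglongrightarrow> ?g (\<gamma>\<phi> l) - ?g (\<gamma>\<phi> l) + \<alpha>\<phi> * norm (\<gamma>\<phi> l - \<gamma>\<phi> l) * norm (\<gamma>\<phi> l - \<gamma>\<phi> l)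
      + f (l - l) + BA * norm (l - l)"
    by (intro tendsto_intros \<phi>_tendsto v_tendsto \<gamma>\<phi>_tendsto v)
  then have "\<forall>\<^sub>F n in sequentially. ?s n < \<kappa>"
    using \<open>\<kappa> > 0\<close> by (intro order_tendstoD) auto
  moreover have "\<forall>\<^sub>F n in sequentially. clarke_deriv j (\<gamma>j (U n)) (\<gamma>j (v n) - \<gamma>j (U n)) < \<kappa>"
    by (rule clarke_deriv_upper_semicontinuous[OF j_lip \<gamma>j_tendsto tendsto_diff[OF v_tendsto(2) \<gamma>j_tendsto]])
       (use \<open>\<kappa> > 0\<close> in \<open>simp add: clarke_deriv_zero\<close>)
  ultimately have "\<forall>\<^sub>F n in sequentially. (A l - f) (U n) \<le> (A l - f) l - 2 * \<kappa>"
    using far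
  proof eventually_elim
    case (elim n)
    have "4 * \<kappa> \<le> mA * (norm (U n - l))\<^sup>2"
      using elim(3) assms mA by (simp add: \<kappa>_def power_mono)
    also have "\<dots> \<le> (A (U n) - A l) (U n - l)" by (rule A_mono)
    also have "\<dots> = A (U n) (U n - v n) + A (U n) (v n - l) - A l (U n - l)"
      by (simp add: blinfun.diff_left blinfun.diff_right)
    also have "\<dots> \<le> \<kappa> + (?s n - f (l - v n)) + f (U n - v n) - A l (U n - l)"
      using test_K[OF v(1,2)[of n]] elim(2) BA(2)[of n "v n - l"]
        \<phi>_freeze[of "\<gamma>\<phi> (U n)" "\<gamma>\<phi> (v n)" "\<gamma>\<phi> l"] by linarith
    finally show ?case
      using elim(1) by (simp add: blinfun.diff_left blinfun.diff_right)
  qed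
  then have "(A l - f) l \<le> (A l - f) l - 2 * \<kappa>" by (rule weak)
  with \<open>\<kappa> > 0\<close> show False by simp
qed

end

section \<open>Identification of the limit with \<open>u\<close>\<close>

context penalized_sequence
begin

text \<open>Strong monotonicity compares \<open>A (U n)\<close> with the fixed functional
  \<open>A u\<close> before passing to the limit. The resulting estimate for \<open>l - u\<close> is
  combined with the inequality for \<open>u\<close>, tested with \<open>l\<close>.\<close>

lemma strong_limit_unique:
  assumes lim: "U \<longlonglongrightarrow> l" and l: "l \<in> K"
  shows "l = u"
proof -
  obtain v where v: "\<And>n. v n \<in> V n" "\<And>n. v n \<in> K" "v \<longlonglongrightarrow> u"
    using V_dense_K[OF u_K] by auto
  obtain BA where BA: "BA > 0" "\<And>n w. \<bar>A (U n) w\<bar> \<le> BA * norm w" using AU_bound by blast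
  have \<gamma>\<phi>_lim: "(\<lambda>n. \<gamma>\<phi> (v n)) \<longlonglongrightarrow> \<gamma>\<phi> u" "(\<lambda>n. \<gamma>\<phi> (U n)) \<longlonglongrightarrow> \<gamma>\<phi> l"
    and \<gamma>j_lim: "(\<lambda>n. \<gamma>j (v n)) \<longlonglongrightarrow> \<gamma>j u" "(\<lambda>n. \<gamma>j (U n)) \<longlonglongrightarrow> \<gamma>j l"
    by (intro tendsto_intros v lim)+
  let ?g = "\<phi> (\<gamma>\<phi> u)"
  define J where "J = clarke_deriv j (\<gamma>j l) (\<gamma>j u - \<gamma>j l)"
  have bound: "mA * (norm (l - u))\<^sup>2 \<le> ?g (\<gamma>\<phi> u) - ?g (\<gamma>\<phi> l)
      + \<alpha>\<phi> * norm (\<gamma>\<phi> l - \<gamma>\<phi> u) * norm (\<gamma>\<phi> l - \<gamma>\<phi> u) + f (l - u) - A u (l - u) + J + \<epsilon>"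
    if "\<epsilon> > 0" for \<epsilon>
  proof -
    let ?s = "\<lambda>n. ?g (\<gamma>\<phi> (v n)) - ?g (\<gamma>\<phi> (U n))
        + \<alpha>\<phi> * norm (\<gamma>\<phi> (U n) - \<gamma>\<phi> u) * norm (\<gamma>\<phi> (U n) - \<gamma>\<phi> (v n))
        + f (U n - v n) + BA * norm (v n - u) - A u (U n - u) + J + \<epsilon>"
    have "?s \<longlonglongrightarrow> ?g (\<gamma>\<phi> u) - ?g (\<gamma>\<phi> l) + \<alpha>\<phi> * norm (\<gamma>\<phi> l - \<gamma>\<phi> u) * norm (\<gamma>\<phi> l - \<gamma>\<phi> u)
        + f (l - u) + BA * norm (u - u) - A u (l - u) + J + \<epsilon>"
      by (intro tendsto_intros \<phi>_tendsto \<gamma>\<phi>_lim v lim)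
    moreover have "(\<lambda>n. mA * (norm (U n - u))\<^sup>2) \<longlonglongrightarrow> mA * (norm (l - u))\<^sup>2"
      by (intro tendsto_intros lim)
    moreover have "\<forall>\<^sub>F n in sequentially. clarke_deriv j (\<gamma>j (U n)) (\<gamma>j (v n) - \<gamma>j (U n)) < J + \<epsilon>"
      by (rule clarke_deriv_upper_semicontinuous[OF j_lip \<gamma>j_lim(2) tendsto_diff[OF \<gamma>j_lim]])
         (use that in \<open>simp add: J_def\<close>)
    then have "\<forall>\<^sub>F n in sequentially. mA * (norm (U n - u))\<^sup>2 \<le> ?s n"
    proof eventually_elim
      case (elim n)
      have "mA * (norm (U n - u))\<^sup>2 \<le> (A (U n) - A u) (U n - u)" by (rule A_mono)
      also have "\<dots> = A (U n) (U n - v n) + A (U n) (v n - u) - A u (U n - u)"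
        by (simp add: blinfun.diff_left blinfun.diff_right)
      also have "\<dots> \<le> ?s n"
        using test_K[OF v(1,2)[of n]] elim BA(2)[of n "v n - u"]
          \<phi>_freeze[of "\<gamma>\<phi> (U n)" "\<gamma>\<phi> (v n)" "\<gamma>\<phi> u"] by linarith
      finally show ?case .
    qed
    ultimately have "mA * (norm (l - u))\<^sup>2 \<le> ?g (\<gamma>\<phi> u) - ?g (\<gamma>\<phi> l)
      + \<alpha>\<phi> * norm (\<gamma>\<phi> l - \<gamma>\<phi> u) * norm (\<gamma>\<phi> l - \<gamma>\<phi> u) + f (l - u) + BA * norm (u - u) - A u (l - u) + J + \<epsilon>"
      by (intro tendsto_le[OF sequentially_bot])
    then show ?thesis by simp
  qed
  have "mA * (norm (l - u))\<^sup>2 \<le> ?g (\<gamma>\<phi> u) - ?g (\<gamma>\<phi> l)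
      + \<alpha>\<phi> * norm (\<gamma>\<phi> l - \<gamma>\<phi> u) * norm (\<gamma>\<phi> l - \<gamma>\<phi> u) + f (l - u) - A u (l - u) + J"
    using bound by (rule field_le_epsilon)
  \<comment> \<open>The inequality for \<open>u\<close> at \<open>l\<close> cancels the
    \<open>f\<close>, \<open>A u\<close> and \<phi>-differences, leaving two Clarke derivatives in
    opposite directions, which \<open>j_le\<close> bounds together.\<close>
  also have "\<dots> \<le> \<alpha>\<phi> * (norm (\<gamma>\<phi> l - \<gamma>\<phi> u))\<^sup>2 + \<alpha>j * (norm (\<gamma>j l - \<gamma>j u))\<^sup>2"
    using u_solves[OF l] j_le[of "\<gamma>j l" "\<gamma>j u"] by (simp add: J_def power2_eq_square)
  also have "\<dots> \<le> \<alpha>\<phi> * (c\<phi> * norm (l - u))\<^sup>2 + \<alpha>j * (cj * norm (l - u))\<^sup>2"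
    using \<alpha>\<phi> \<alpha>j c\<phi>(2)[of "l - u"] cj(2)[of "l - u"]
    by (intro add_mono mult_left_mono power_mono) (auto simp: blinfun.diff_right)
  also have "\<dots> = (\<alpha>\<phi> * c\<phi>\<^sup>2 + \<alpha>j * cj\<^sup>2) * (norm (l - u))\<^sup>2"
    by (simp add: power_mult_distrib algebra_simps)
  finally have "(mA - (\<alpha>\<phi> * c\<phi>\<^sup>2 + \<alpha>j * cj\<^sup>2)) * (norm (l - u))\<^sup>2 \<le> 0"
    by (simp add: left_diff_distrib)
  with small have "(norm (l - u))\<^sup>2 \<le> 0" by (simp only: mult_le_0_iff) linarith
  then show ?thesis by simp
qed

text \<open>Subsequences are extracted for the two compact operators in turn. The point
  \<open>l\<close> is chosen last, along the final subsequence, so that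
  \<open>weak_cluster_image\<close> identifies both limits.\<close>

lemma weak_limit:
  obtains r l where "strict_mono (r :: nat \<Rightarrow> nat)"
    "penalized_sequence_weak_limit K \<gamma>\<phi> \<gamma>j A P \<phi> j f c\<phi> cj mA \<alpha>\<phi> \<alpha>j u
      (\<lambda>n. V (r n)) (\<lambda>n. e (r n)) (\<lambda>n. U (r n)) l"
proof -
  have Bseq_sub: "Bseq (\<lambda>n. U (r n))" for r :: "nat \<Rightarrow> nat"
    using bounded by (rule Bseq_subseq)
  obtain r1 z\<phi> where r1: "strict_mono (r1 :: nat \<Rightarrow> nat)" "(\<lambda>n. \<gamma>\<phi> (U (r1 n))) \<longlonglongrightarrow> z\<phi>"
    using compact_operator_subsequence[OF compact(1) bounded] by blast
  obtain r2 zj where r2: "strict_mono (r2 :: nat \<Rightarrow> nat)" "(\<lambda>n. \<gamma>j (U (r1 (r2 n)))) \<longlonglongrightarrow> zj"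
    using compact_operator_subsequence[OF compact(2) Bseq_sub[of r1]] by blast
  define r where "r n = r1 (r2 n)" for n
  have r: "strict_mono r"
    using r1(1) r2(1) by (simp add: r_def strict_mono_def)
  obtain l where l: "\<And>(\<zeta> :: 'x \<Rightarrow>\<^sub>L real) c.
      \<forall>\<^sub>F n in sequentially. \<zeta> (U (r n)) \<le> c \<Longrightarrow> \<zeta> l \<le> c"
    using reflexive_weak_cluster_point[OF reflexive Bseq_sub[of r]] by blast
  have \<phi>: "(\<lambda>n. \<gamma>\<phi> (U (r n))) \<longlonglongrightarrow> z\<phi>"
    using LIMSEQ_subseq_LIMSEQ[OF r1(2) r2(1)] by (simp add: r_def o_def)
  have j: "(\<lambda>n. \<gamma>j (U (r n))) \<longlonglongrightarrow> zj"
    using r2(2) by (simp add: r_def)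
  have "z\<phi> = \<gamma>\<phi> l" using l \<phi> by (rule weak_cluster_image)
  moreover have "zj = \<gamma>j l" using l j by (rule weak_cluster_image)
  moreover have "penalized_sequence K \<gamma>\<phi> \<gamma>j A P \<phi> j f c\<phi> cj mA \<alpha>\<phi> \<alpha>j u
      (\<lambda>n. V (r n)) (\<lambda>n. e (r n)) (\<lambda>n. U (r n))"
    using r by (intro subsequence filterlim_subseq)
  ultimately have "penalized_sequence_weak_limit K \<gamma>\<phi> \<gamma>j A P \<phi> j f c\<phi> cj mA \<alpha>\<phi> \<alpha>j u
      (\<lambda>n. V (r n)) (\<lambda>n. e (r n)) (\<lambda>n. U (r n)) l"
    using l \<phi> j
    by (auto simp: penalized_sequence_weak_limit_def penalized_sequence_weak_limit_axioms_def)
  with r show ?thesis by (rule that)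
qed

text \<open>Indices \<open>s n \<ge> n\<close> at which the distance to \<open>l\<close> is below
  \<open>inverse (real (Suc n))\<close> give a strongly convergent sequence of solutions; its limit
  \<open>l\<close> lies in \<open>K\<close>, hence equals \<open>u\<close>.\<close>

lemma comes_close:
  assumes "\<eta> > 0"
  shows "\<exists>n. norm (U n - u) < \<eta>"
proof -
  obtain r l where r: "strict_mono (r :: nat \<Rightarrow> nat)"
    and loc: "penalized_sequence_weak_limit K \<gamma>\<phi> \<gamma>j A P \<phi> j f c\<phi> cj mA \<alpha>\<phi> \<alpha>j u
      (\<lambda>n. V (r n)) (\<lambda>n. e (r n)) (\<lambda>n. U (r n)) l"
    by (rule weak_limit)
  interpret W: penalized_sequence_weak_limit K \<gamma>\<phi> \<gamma>j A P \<phi> j f c\<phi> cj mA \<alpha>\<phi> \<alpha>j u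
      "\<lambda>n. V (r n)" "\<lambda>n. e (r n)" "\<lambda>n. U (r n)" l
    by (rule loc)
  have "\<exists>k\<ge>n. norm (U (r k) - l) < inverse (real (Suc n))" for n
    using W.frequently_close[of "inverse (real (Suc n))"] by (auto simp: frequently_sequentially)
  then obtain s where s: "\<And>n. s n \<ge> n" "\<And>n. norm (U (r (s n)) - l) < inverse (real (Suc n))"
    by metis
  have "filterlim s sequentially sequentially"
    using s(1) by (auto intro: filterlim_at_top_mono[OF filterlim_ident])
  then interpret S: penalized_sequence K \<gamma>\<phi> \<gamma>j A P \<phi> j f c\<phi> cj mA \<alpha>\<phi> \<alpha>j u
      "\<lambda>n. V (r (s n))" "\<lambda>n. e (r (s n))" "\<lambda>n. U (r (s n))"
    by (rule W.subsequence)
  have "(\<lambda>n. U (r (s n)) - l) \<longlonglongrightarrow> 0"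
    by (rule Lim_null_comparison[OF always_eventually LIMSEQ_inverse_real_of_nat])
       (intro allI less_imp_le s(2))
  then have lim: "(\<lambda>n. U (r (s n))) \<longlonglongrightarrow> l" by (simp add: LIM_zero_iff)
  then have "(\<lambda>n. U (r (s n))) \<longlonglongrightarrow> u" using S.strong_limit_unique[OF lim W.l_in_K] by simp
  then obtain n where "norm (U (r (s n)) - u) < \<eta>"
    using assms by (auto dest!: LIMSEQ_D)
  then show ?thesis by blast
qed

end

section \<open>From sequences to independent parameters\<close>

theorem theorem5p1:
  fixes K :: "'x::banach set"
    and \<gamma>\<phi> :: "'x \<Rightarrow>\<^sub>L 'p::banach"
    and \<gamma>j :: "'x \<Rightarrow>\<^sub>L 'j::banach"
    and A P :: "'x \<Rightarrow> ('x \<Rightarrow>\<^sub>L real)"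
    and \<phi> :: "'p \<Rightarrow> 'p \<Rightarrow> real"
    and j :: "'j \<Rightarrow> real"
    and f :: "'x \<Rightarrow>\<^sub>L real"
    and c\<phi> cj mA \<alpha>\<phi> \<alpha>j c0 c1 :: real
    and Xh :: "real \<Rightarrow> 'x set"
    and u :: 'x
    and uh :: "real \<Rightarrow> real \<Rightarrow> 'x"
  assumes A1: "reflexive_space TYPE('x)" "K \<noteq> UNIV" "K \<noteq> {}" "closed K" "convex K"
    and A2: "c\<phi> > 0" "\<forall>v. norm (blinfun_apply \<gamma>\<phi> v) \<le> c\<phi> * norm v"
    and A3: "cj > 0" "\<forall>v. norm (blinfun_apply \<gamma>j v) \<le> cj * norm v"
    and A4: "pseudomonotone A" "mA > 0"
      "\<forall>v1 v2. blinfun_apply (A v1 - A v2) (v1 - v2) \<ge> mA * (norm (v1 - v2))\<^sup>2"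
    and A5: "\<forall>z. convex_on UNIV (\<phi> z) \<and> lower_semicontinuous (\<phi> z)" "\<alpha>\<phi> \<ge> 0"
      "\<forall>z1 z2 z3 z4. \<phi> z1 z4 - \<phi> z1 z3 + \<phi> z2 z3 - \<phi> z2 z4
         \<le> \<alpha>\<phi> * norm (z1 - z2) * norm (z3 - z4)"
    and A6: "locally_lipschitz j" "c0 \<ge> 0" "c1 \<ge> 0" "\<alpha>j \<ge> 0"
      "\<forall>z. \<forall>\<zeta> \<in> clarke_subdiff j z. norm \<zeta> \<le> c0 + c1 * norm z"
      "\<forall>z1 z2. clarke_deriv j z1 (z2 - z1) + clarke_deriv j z2 (z1 - z2)
         \<le> \<alpha>j * (norm (z1 - z2))\<^sup>2"
    and A7: "\<alpha>\<phi> * c\<phi>\<^sup>2 + \<alpha>j * cj\<^sup>2 < mA"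
    and A9: "\<forall>h>0. subspace (Xh h) \<and> (\<exists>B. finite B \<and> Xh h = span B)"
      "\<forall>v. \<exists>vh. (\<forall>h>0. vh h \<in> Xh h) \<and> ((\<lambda>h. norm (vh h - v)) \<longlongrightarrow> 0) (at_right 0)"
      "\<forall>v\<in>K. \<exists>vh. (\<forall>h>0. vh h \<in> Xh h \<inter> K) \<and> ((\<lambda>h. norm (vh h - v)) \<longlongrightarrow> 0) (at_right 0)"
    and A10: "compact_operator (blinfun_apply \<gamma>\<phi>)" "compact_operator (blinfun_apply \<gamma>j)"
    and P: "penalty_operator P K"
    and u: "u \<in> K"
      "\<forall>v\<in>K. blinfun_apply (A u) (v - u)
          + \<phi> (blinfun_apply \<gamma>\<phi> u) (blinfun_apply \<gamma>\<phi> v)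
          - \<phi> (blinfun_apply \<gamma>\<phi> u) (blinfun_apply \<gamma>\<phi> u)
          + clarke_deriv j (blinfun_apply \<gamma>j u) (blinfun_apply \<gamma>j v - blinfun_apply \<gamma>j u)
        \<ge> blinfun_apply f (v - u)"
    and uh: "\<forall>h>0. \<forall>\<epsilon>>0. uh h \<epsilon> \<in> Xh h"
      "\<forall>h>0. \<forall>\<epsilon>>0. \<forall>v\<in>Xh h. blinfun_apply (A (uh h \<epsilon>)) (v - uh h \<epsilon>)
          + (1 / \<epsilon>) * blinfun_apply (P (uh h \<epsilon>)) (v - uh h \<epsilon>)
          + \<phi> (blinfun_apply \<gamma>\<phi> (uh h \<epsilon>)) (blinfun_apply \<gamma>\<phi> v)
          - \<phi> (blinfun_apply \<gamma>\<phi> (uh h \<epsilon>)) (blinfun_apply \<gamma>\<phi> (uh h \<epsilon>))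
          + clarke_deriv j (blinfun_apply \<gamma>j (uh h \<epsilon>))
              (blinfun_apply \<gamma>j v - blinfun_apply \<gamma>j (uh h \<epsilon>))
        \<ge> blinfun_apply f (v - uh h \<epsilon>)"
  shows "\<forall>\<eta>>0. \<exists>h0>0. \<exists>\<epsilon>0>0. \<forall>h \<epsilon>. 0 < h \<and> h < h0 \<and> 0 < \<epsilon> \<and> \<epsilon> < \<epsilon>0 \<longrightarrow>
           norm (uh h \<epsilon> - u) < \<eta>"
proof (rule ccontr)
  assume "\<not> ?thesis"
  then obtain \<eta> where "\<eta> > 0"
    and far: "\<And>a b. a > 0 \<Longrightarrow> b > 0 \<Longrightarrow>
      \<exists>h \<epsilon>. 0 < h \<and> h < a \<and> 0 < \<epsilon> \<and> \<epsilon> < b \<and> \<not> norm (uh h \<epsilon> - u) < \<eta>"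
    by metis
  \<comment> \<open>Taking both thresholds equal to \<open>a n\<close> turns the failure of the
    two-parameter limit into one sequence of pairs with both components tending to zero.\<close>
  define a where "a n = inverse (real (Suc n))" for n
  have "a n > 0" for n by (simp add: a_def)
  then have "\<exists>h \<epsilon>. 0 < h \<and> h < a n \<and> 0 < \<epsilon> \<and> \<epsilon> < a n \<and> \<not> norm (uh h \<epsilon> - u) < \<eta>" for n
    using far by blast
  then obtain h e where h: "\<And>n. 0 < h n" "\<And>n. h n < a n" and e: "\<And>n. 0 < e n" "\<And>n. e n < a n"
    and far_n: "\<And>n. \<not> norm (uh (h n) (e n) - u) < \<eta>"
    by metis
  have a0: "a \<longlonglongrightarrow> 0" unfolding a_def by (rule LIMSEQ_inverse_real_of_nat)
  have h0: "h \<longlonglongrightarrow> 0"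
    by (rule tendsto_sandwich[OF _ _ tendsto_const a0]) (intro always_eventually allI less_imp_le h)+
  have e0: "e \<longlonglongrightarrow> 0"
    by (rule tendsto_sandwich[OF _ _ tendsto_const a0]) (intro always_eventually allI less_imp_le e)+
  \<comment> \<open>The approximation hypotheses are limits from the right at \<open>0\<close>, so
    positivity of \<open>h n\<close> is needed besides convergence.\<close>
  have right: "filterlim h (at_right 0) sequentially"
    using h0 by (simp add: filterlim_at h(1) h(1)[THEN order_less_imp_not_eq2])
  have along: "(\<lambda>n. vh (h n)) \<longlonglongrightarrow> v" if "((\<lambda>h. norm (vh h - v)) \<longlongrightarrow> 0) (at_right 0)"
    for vh :: "real \<Rightarrow> 'x" and v
    using filterlim_compose[OF that right] by (simp add: tendsto_norm_zero_iff LIM_zero_iff)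
  interpret penalized_sequence K \<gamma>\<phi> \<gamma>j A P \<phi> j f c\<phi> cj mA \<alpha>\<phi> \<alpha>j u
    "\<lambda>n. Xh (h n)" e "\<lambda>n. uh (h n) (e n)"
  proof unfold_locales
    fix v
    obtain vh where "\<forall>h>0. vh h \<in> Xh h" "((\<lambda>h. norm (vh h - v)) \<longlongrightarrow> 0) (at_right 0)"
      using A9(2) by blast
    then show "\<exists>v'. (\<forall>n. v' n \<in> Xh (h n)) \<and> v' \<longlonglongrightarrow> v"
      using along[of vh v] h(1) by (intro exI[of _ "\<lambda>n. vh (h n)"]) simp
  next
    fix v assume "v \<in> K"
    then obtain vh where "\<forall>h>0. vh h \<in> Xh h \<inter> K" "((\<lambda>h. norm (vh h - v)) \<longlongrightarrow> 0) (at_right 0)"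
      using A9(3) by blast
    then show "\<exists>v'. (\<forall>n. v' n \<in> Xh (h n) \<inter> K) \<and> v' \<longlonglongrightarrow> v"
      using along[of vh v] h(1) by (intro exI[of _ "\<lambda>n. vh (h n)"]) simp
  next
    show "bounded_operator A" using A4(1) by (simp add: pseudomonotone_def)
  next
    fix n v assume "v \<in> Xh (h n)"
    with uh(2) h(1)[of n] e(1)[of n]
    show "f (v - uh (h n) (e n)) \<le> A (uh (h n) (e n)) (v - uh (h n) (e n))
          + (1 / e n) * P (uh (h n) (e n)) (v - uh (h n) (e n))
          + \<phi> (\<gamma>\<phi> (uh (h n) (e n))) (\<gamma>\<phi> v) - \<phi> (\<gamma>\<phi> (uh (h n) (e n))) (\<gamma>\<phi> (uh (h n) (e n)))
          + clarke_deriv j (\<gamma>j (uh (h n) (e n))) (\<gamma>j v - \<gamma>j (uh (h n) (e n)))"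
      by blast
  qed (use A1 A2 A3 A4 A5 A6 A7 A10 P u e0 e in auto)
  from comes_close[OF \<open>\<eta> > 0\<close>] far_n show False by blast
qed

end
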